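(* Let $\mathbf{x}:(U,0)\to(\mathbb{R}^3,0)$ be a germ of a wavefront, $\mathbf{\Omega}$ a tangent moving basis of $\mathbf{x}$ and $0\in\Sigma(\mathbf{x})$ with $\mathrm{rank}(D\mathbf{x}(0))=1$. Then, up to an isometry of $\mathbb{R}^3$, $\mathbf{x}$ is $\mathscr{R}$-equivalent to $$\mathbf{y}(w,z)=\Big(w,\ \int_0^z\lambda_{\hat\Omega}(w,t)\,dt+f_1(w),\ \int_0^z t\,\lambda_{\hat\Omega}(w,t)\,dt+f_2(w)\Big),$$ which has as tangent moving basis $$\hat{\mathbf{\Omega}}=\begin{pmatrix}\mathbf{y}_w & \begin{matrix} 0 \\ 1 \\ z \end{matrix}\end{pmatrix},\qquad \mathbf{\Lambda}_{\hat\Omega}=\begin{pmatrix} 1 & 0 \\ 0 & \lambda_{\hat\Omega} \end{pmatrix},$$ where $\lambda_{\hat\Omega}(w,z)$, $f_1(w)$, $f_2(w)$ are smooth functions with $\lambda_{\hat\Omega}(0)=0$. In particular, $\mathbf{x}$ is $\mathscr{A}$-equivalent to $\big(w,\int_0^z\lambda_{\hat\Omega}(w,t)\,dt,\int_0^z t\,\lambda_{\hat\Omega}(w,t)\,dt\big)$.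
   Context: All maps are $C^\infty$ and $U\subset\mathbb{R}^2$ is open. $D$ denotes the Jacobian matrix. A tangent moving basis (tmb) of $\mathbf{x}:U\to\mathbb{R}^3$ is a smooth map $\mathbf{\Omega}=(\mathbf{w}_1\ \mathbf{w}_2):U\to\mathcal{M}_{3\times2}(\mathbb{R})$ with columns linearly independent at every point and $\mathbf{x}_u,\mathbf{x}_v\in\mathrm{span}(\mathbf{w}_1,\mathbf{w}_2)$. The map $\mathbf{x}$ is a frontal if near each point $p$ there is a smooth unit vector field $\mathbf{n}_p$ orthogonal to $\mathbf{x}_u,\mathbf{x}_v$ (equivalently, tmbs exist locally; a global tmb is always assumed), and a wavefront if moreover each $(\mathbf{x},\mathbf{n}_p)$ is an immersion into $\mathbb{R}^3\times S^2$. $\Sigma(\mathbf{x})$ is the set of points where $\mathbf{x}$ is not immersive. $\mathbf{\Lambda}_\Omega=D\mathbf{x}^T\mathbf{\Omega}(\mathbf{\Omega}^T\mathbf{\Omega})^{-1}$, so $D\mathbf{x}=\mathbf{\Omega}\mathbf{\Lambda}_\Omega^T$, and $\lambda_\Omega=\det\mathbf{\Lambda}_\Omega$ (so $\lambda_{\hat\Omega}=\det\mathbf{\Lambda}_{\hat\Omega}$). Two map germs $\mathbf{f}_1:(U_1,p)\to(\mathbb{R}^n,q)$, $\mathbf{f}_2:(U_2,p)\to(\mathbb{R}^n,q)$ are $\mathscr{R}$-equivalent if $\mathbf{f}_2=\mathbf{f}_1\circ\mathbf{h}$ for a diffeomorphism germ $\mathbf{h}:(U_2,p)\to(U_1,p)$,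 and $\mathscr{A}$-equivalent if $\mathbf{f}_2=\mathbf{k}\circ\mathbf{f}_1\circ\mathbf{h}$ for such $\mathbf{h}$ and a diffeomorphism germ $\mathbf{k}:(\mathbb{R}^n,q)\to(\mathbb{R}^n,q)$. "Up to an isometry" means after composing $\mathbf{x}$ on the left with an isometry of $\mathbb{R}^3$. *)

theory Defs
  imports "HOL-Analysis.Analysis"
begin

text \<open>Smoothness, for use on open sets: \<open>f\<close> is of class \<open>C\<^sup>k\<close> if it is differentiable and all its
  directional derivatives are of class \<open>C\<^sup>k\<^sup>-\<^sup>1\<close>.\<close>

primrec Ck_on :: "nat \<Rightarrow> 'a::real_normed_vector set \<Rightarrow> ('a \<Rightarrow> 'b::real_normed_vector) \<Rightarrow> bool" where
  "Ck_on 0 S f \<longleftrightarrow> continuous_on S f"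
| "Ck_on (Suc k) S f \<longleftrightarrow>
     (\<forall>p\<in>S. f differentiable (at p)) \<and> (\<forall>v. Ck_on k S (\<lambda>p. frechet_derivative f (at p) v))"

definition smooth_on :: "'a::real_normed_vector set \<Rightarrow> ('a \<Rightarrow> 'b::real_normed_vector) \<Rightarrow> bool" where
  "smooth_on S f \<longleftrightarrow> (\<forall>k. Ck_on k S f)"

definition immersive_at :: "('a::real_normed_vector \<Rightarrow> 'b::real_normed_vector) \<Rightarrow> 'a \<Rightarrow> bool" where
  "immersive_at f p \<longleftrightarrow> f differentiable (at p) \<and> inj (frechet_derivative f (at p))"

definition singular_set :: "(real^2) set \<Rightarrow> (real^2 \<Rightarrow> real^3) \<Rightarrow> (real^2) set" where
  "singular_set U x = {p \<in> U. \<not> immersive_at x p}"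

text \<open>The columns of \<open>jacobian x (at p)\<close> are the partial derivatives of \<open>x\<close> at \<open>p\<close>.
  A \<open>3 \<times> 2\<close> matrix has type \<^typ>\<open>real^2^3\<close>.\<close>

definition tangent_moving_basis ::
  "(real^2) set \<Rightarrow> (real^2 \<Rightarrow> real^3) \<Rightarrow> (real^2 \<Rightarrow> real^2^3) \<Rightarrow> bool" where
  "tangent_moving_basis U x \<Omega> \<longleftrightarrow>
     smooth_on U x \<and> smooth_on U \<Omega> \<and>
     (\<forall>p\<in>U. column 1 (\<Omega> p) \<noteq> column 2 (\<Omega> p) \<and>
            independent {column 1 (\<Omega> p), column 2 (\<Omega> p)} \<and>
            (\<forall>j. column j (jacobian x (at p)) \<in> span {column 1 (\<Omega> p), column 2 (\<Omega> p)}))"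

definition unit_normal_field :: "(real^2) set \<Rightarrow> (real^2 \<Rightarrow> real^3) \<Rightarrow> (real^2 \<Rightarrow> real^3) \<Rightarrow> bool" where
  "unit_normal_field V x n \<longleftrightarrow>
     smooth_on V n \<and>
     (\<forall>q\<in>V. norm (n q) = 1 \<and> (\<forall>j. n q \<bullet> column j (jacobian x (at q)) = 0))"

definition frontal :: "(real^2) set \<Rightarrow> (real^2 \<Rightarrow> real^3) \<Rightarrow> bool" where
  "frontal U x \<longleftrightarrow>
     smooth_on U x \<and> (\<forall>p\<in>U. \<exists>V n. open V \<and> p \<in> V \<and> V \<subseteq> U \<and> unit_normal_field V x n)"

text \<open>Since the unit sphere is a submanifold of \<open>\<real>\<^sup>3\<close>, being an immersion into \<open>\<real>\<^sup>3 \<times> S\<^sup>2\<close> is the same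
  as being an immersion into \<open>\<real>\<^sup>3 \<times> \<real>\<^sup>3\<close>.\<close>

definition wavefront :: "(real^2) set \<Rightarrow> (real^2 \<Rightarrow> real^3) \<Rightarrow> bool" where
  "wavefront U x \<longleftrightarrow>
     frontal U x \<and>
     (\<forall>p\<in>U. \<exists>V n. open V \<and> p \<in> V \<and> V \<subseteq> U \<and> unit_normal_field V x n \<and>
                  (\<forall>q\<in>V. immersive_at (\<lambda>r. (x r, n r)) q))"

definition tmb_Lambda :: "(real^2 \<Rightarrow> real^3) \<Rightarrow> (real^2 \<Rightarrow> real^2^3) \<Rightarrow> real^2 \<Rightarrow> real^2^2" where
  "tmb_Lambda x \<Omega> p =
     transpose (jacobian x (at p)) ** \<Omega> p ** matrix_inv (transpose (\<Omega> p) ** \<Omega> p)"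

definition tmb_lambda :: "(real^2 \<Rightarrow> real^3) \<Rightarrow> (real^2 \<Rightarrow> real^2^3) \<Rightarrow> real^2 \<Rightarrow> real" where
  "tmb_lambda x \<Omega> p = det (tmb_Lambda x \<Omega> p)"

text \<open>A germ at \<open>p\<close> is represented by a total function of which only the values near \<open>p\<close> matter.\<close>

definition diffeo_germ ::
  "('a::real_normed_vector \<Rightarrow> 'b::real_normed_vector) \<Rightarrow> 'a \<Rightarrow> 'b \<Rightarrow> bool" where
  "diffeo_germ h p q \<longleftrightarrow>
     h p = q \<and>
     (\<exists>A B g. open A \<and> open B \<and> p \<in> A \<and> homeomorphism A B h g \<and> smooth_on A h \<and> smooth_on B g)"

definition R_equivalent ::
  "'a::real_normed_vector \<Rightarrow> 'b::real_normed_vector \<Rightarrow> ('a \<Rightarrow> 'b) \<Rightarrow> ('a \<Rightarrow> 'b) \<Rightarrow> bool" where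
  "R_equivalent p q F1 F2 \<longleftrightarrow>
     F1 p = q \<and> F2 p = q \<and>
     (\<exists>h. diffeo_germ h p p \<and> (\<forall>\<^sub>F r in nhds p. F2 r = F1 (h r)))"

definition A_equivalent ::
  "'a::real_normed_vector \<Rightarrow> 'b::real_normed_vector \<Rightarrow> ('a \<Rightarrow> 'b) \<Rightarrow> ('a \<Rightarrow> 'b) \<Rightarrow> bool" where
  "A_equivalent p q F1 F2 \<longleftrightarrow>
     F1 p = q \<and> F2 p = q \<and>
     (\<exists>h k. diffeo_germ h p p \<and> diffeo_germ k q q \<and> (\<forall>\<^sub>F r in nhds p. F2 r = k (F1 (h r))))"

text \<open>The point with coordinates \<open>(w, z)\<close> is \<open>p\<close> with \<open>p $ 1 = w\<close> and \<open>p $ 2 = z\<close>; the integrals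
  are oriented, so \<open>z\<close> may be negative.\<close>

definition normal_form ::
  "(real^2 \<Rightarrow> real) \<Rightarrow> (real \<Rightarrow> real) \<Rightarrow> (real \<Rightarrow> real) \<Rightarrow> real^2 \<Rightarrow> real^3" where
  "normal_form l f1 f2 p =
     vector [p $ 1,
             (LBINT t=0..p $ 2. l (vector [p $ 1, t])) + f1 (p $ 1),
             (LBINT t=0..p $ 2. t * l (vector [p $ 1, t])) + f2 (p $ 1)]"

text \<open>The \<open>3 \<times> 2\<close> matrix with columns \<open>y\<^sub>w\<close> and \<open>(0, 1, z)\<close>.\<close>

definition adapted_basis :: "(real^2 \<Rightarrow> real^3) \<Rightarrow> real^2 \<Rightarrow> real^2^3" where
  "adapted_basis y p = transpose (vector [column 1 (jacobian y (at p)), vector [0, 1, p $ 2]])"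

end

theory Submission
  imports Defs
begin

text \<open>
  Let \<open>n\<close> be a unit normal of \<open>x\<close> near \<open>0\<close>. Since \<open>Dx(0)\<close> has rank one, an isometry \<open>T\<close> of \<open>\<real>\<^sup>3\<close> turns
  the image of \<open>Dx(0)\<close> into the first axis and \<open>n(0)\<close> into the third one; write \<open>X = T \<circ> x\<close> and
  \<open>N = T \<circ> n\<close>. The new parameters are \<open>w = X\<^sub>1\<close>, the coordinate in which \<open>X\<close> is immersive, and
  \<open>z = - N\<^sub>2 / N\<^sub>3\<close>, the slope for which \<open>(0, 1, z)\<close> is orthogonal to \<open>N\<close>.

  That \<open>(w, z)\<close> is a local diffeomorphism is where the wavefront condition enters. On the kernel
  of \<open>DX(0)\<close> the derivative of \<open>w\<close> vanishes, while \<open>DN(0)\<close> does not. The third component of \<open>DN(0)\<close>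
  is zero because \<open>N\<close> has unit length, and its first component is zero on the kernel because
  \<open>DN(0)a \<bullet> DX(0)b\<close> is symmetric in \<open>a\<close> and \<open>b\<close>, by symmetry of the second derivative of \<open>X\<close>. So the
  second component, which up to sign is the derivative of \<open>z\<close>, is nonzero on the kernel. This is
  \<open>adapted_coordinates\<close>, and \<open>isometry_to_adapted_position\<close> supplies the isometry.

  Let \<open>Y(w, z)\<close> be \<open>X\<close> in these parameters. Then \<open>Y\<^sub>1 = w\<close>, so \<open>\<partial>Y/\<partial>z\<close> has no first component; being
  orthogonal to \<open>N\<close> it is a multiple \<open>l \<cdot> (0, 1, z)\<close>, with \<open>l = \<partial>Y\<^sub>2/\<partial>z\<close>. Integrating in \<open>z\<close> from the line
  \<open>z = 0\<close> gives the integral formula (\<open>normal_form_of_vertical_derivative\<close>), with \<open>f1\<close> and \<open>f2\<close> the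
  components of \<open>Y\<close> on that line. The Jacobian of \<open>Y\<close> is the adapted basis times \<open>diag(1, l)\<close>, which
  identifies \<open>\<Lambda>\<close> (\<open>adapted_basis_is_tangent_moving_basis\<close>). As \<open>f1\<close> and \<open>f2\<close> depend only on the first
  coordinate of the image, a shear of \<open>\<real>\<^sup>3\<close> removes them.

  The smoothness of all these maps rests on a small calculus of \<open>C\<^sup>k\<close> maps and on the fact that the
  local inverse of a smooth map is smooth.
\<close>

section \<open>Calculus of smooth maps\<close>

lemma Ck_on_subset: "Ck_on k S f \<Longrightarrow> T \<subseteq> S \<Longrightarrow> Ck_on k T f"
  by (induction k arbitrary: f) (auto intro: continuous_on_subset)

lemma Ck_on_cong:
  assumes "open S" "Ck_on k S f" "\<And>p. p \<in> S \<Longrightarrow> f p = g p"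
  shows "Ck_on k S g"
  using assms(2,3)
proof (induction k arbitrary: f g)
  case 0
  then show ?case by (simp cong: continuous_on_cong)
next
  case (Suc k)
  have *: "(g has_derivative frechet_derivative f (at p)) (at p)" if "p \<in> S" for p
  proof (rule has_derivative_transform_within_open[OF _ \<open>open S\<close> that Suc.prems(2)])
    show "(f has_derivative frechet_derivative f (at p)) (at p)"
      using Suc.prems(1) that by (simp add: frechet_derivative_works)
  qed
  then have "frechet_derivative f (at p) v = frechet_derivative g (at p) v" if "p \<in> S" for p v
    using that by (metis frechet_derivative_at)
  then have "Ck_on k S (\<lambda>p. frechet_derivative g (at p) v)" for v
    using Suc.IH[of "\<lambda>p. frechet_derivative f (at p) v"] Suc.prems by auto
  with * show ?case
    by (auto simp: differentiable_def)
qed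

text \<open>In the inductions below the derivative is known by a formula (a product rule, a chain rule); this
  rule lets the formula stand in for \<^const>\<open>frechet_derivative\<close>, which it equals only on \<open>S\<close>.\<close>

lemma Ck_on_SucI:
  assumes "open S" "\<And>p. p \<in> S \<Longrightarrow> (f has_derivative f' p) (at p)"
    and "\<And>v. Ck_on k S (\<lambda>p. f' p v)"
  shows "Ck_on (Suc k) S f"
proof -
  have "f' p v = frechet_derivative f (at p) v" if "p \<in> S" for p v
    using assms(2)[OF that] by (metis frechet_derivative_at)
  then have "Ck_on k S (\<lambda>p. frechet_derivative f (at p) v)" for v
    using Ck_on_cong[OF \<open>open S\<close> assms(3)[of v]] by auto
  then show ?thesis
    using assms(2) by (auto simp: differentiable_def)
qed

lemma Ck_on_Suc_has_derivative:
  "Ck_on (Suc k) S f \<Longrightarrow> p \<in> S \<Longrightarrow> (f has_derivative frechet_derivative f (at p)) (at p)"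
  by (simp only: Ck_on.simps flip: frechet_derivative_works)

lemma Ck_on_SucD: "Ck_on (Suc k) S f \<Longrightarrow> Ck_on k S f"
proof (induction k arbitrary: f)
  case 0
  then have "continuous_on S f"
    by (intro continuous_at_imp_continuous_on ballI differentiable_imp_continuous_within)
      (simp only: Ck_on.simps)
  then show ?case by simp
next
  case (Suc k)
  have "Ck_on k S (\<lambda>p. frechet_derivative f (at p) v)" for v
    using Suc.prems by (intro Suc.IH) (metis Ck_on.simps(2))
  then show ?case using Suc.prems by (metis Ck_on.simps(2))
qed

lemma Ck_on_const: "open S \<Longrightarrow> Ck_on k S (\<lambda>p. c)"
proof (induction k arbitrary: c)
  case (Suc k)
  then show ?case by (intro Ck_on_SucI[where f' = "\<lambda>p v. 0"]) auto
qed auto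

lemma Ck_on_bounded_linear:
  assumes "bounded_linear L" "open S" "Ck_on k S f"
  shows "Ck_on k S (\<lambda>p. L (f p))"
  using assms(3)
proof (induction k arbitrary: f)
  case 0
  then show ?case using bounded_linear.continuous_on[OF assms(1)] by auto
next
  case (Suc k)
  show ?case
  proof (rule Ck_on_SucI[OF \<open>open S\<close>])
    show "((\<lambda>p. L (f p)) has_derivative (\<lambda>v. L (frechet_derivative f (at p) v))) (at p)"
      if "p \<in> S" for p
      using bounded_linear.has_derivative[OF assms(1) Ck_on_Suc_has_derivative[OF Suc.prems that]] .
  qed (use Suc in auto)
qed

lemma Ck_on_ident: "open S \<Longrightarrow> Ck_on k S (\<lambda>p. p)"
proof (cases k)
  case (Suc j)
  assume "open S"
  then show ?thesis
    unfolding Suc by (intro Ck_on_SucI[where f' = "\<lambda>p v. v"] Ck_on_const) auto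
qed auto

lemma Ck_on_add:
  assumes "open S" "Ck_on k S f" "Ck_on k S g"
  shows "Ck_on k S (\<lambda>p. f p + g p)"
  using assms(2,3)
proof (induction k arbitrary: f g)
  case (Suc k)
  show ?case
  proof (rule Ck_on_SucI[OF \<open>open S\<close>])
    show "((\<lambda>p. f p + g p) has_derivative
        (\<lambda>v. frechet_derivative f (at p) v + frechet_derivative g (at p) v)) (at p)"
      if "p \<in> S" for p
      using Suc.prems that by (intro has_derivative_add Ck_on_Suc_has_derivative)
  qed (use Suc in auto)
qed (auto intro: continuous_on_add)

lemma Ck_on_bilinear:
  assumes "bounded_bilinear B" "open S" "Ck_on k S f" "Ck_on k S g"
  shows "Ck_on k S (\<lambda>p. B (f p) (g p))"
  using assms(3,4)
proof (induction k arbitrary: f g)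
  case 0
  then show ?case using bounded_bilinear.continuous_on[OF assms(1)] by auto
next
  case (Suc k)
  note Ck = Suc.prems[THEN Ck_on_SucD]
  show ?case
  proof (rule Ck_on_SucI[OF \<open>open S\<close>])
    show "((\<lambda>p. B (f p) (g p)) has_derivative
        (\<lambda>v. B (f p) (frechet_derivative g (at p) v) + B (frechet_derivative f (at p) v) (g p))) (at p)"
      if "p \<in> S" for p
      using Suc.prems that
      by (intro bounded_bilinear.FDERIV[OF assms(1)] Ck_on_Suc_has_derivative)
    show "Ck_on k S (\<lambda>p. B (f p) (frechet_derivative g (at p) v)
        + B (frechet_derivative f (at p) v) (g p))" for v
      using Suc.prems Ck by (intro Ck_on_add Suc.IH \<open>open S\<close>) auto
  qed
qed

text \<open>The derivative of \<open>1/f\<close> is a product of \<open>1/f\<close> itself, which is \<open>C\<^sup>k\<close> by induction, and of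
  \<open>Df\<close>.\<close>

lemma Ck_on_inverse:
  fixes f :: "'a::real_normed_vector \<Rightarrow> real"
  assumes "open S" "Ck_on k S f" "\<And>p. p \<in> S \<Longrightarrow> f p \<noteq> 0"
  shows "Ck_on k S (\<lambda>p. inverse (f p))"
  using assms(2)
proof (induction k)
  case 0
  then show ?case using assms(3) by (simp add: continuous_on_inverse)
next
  case (Suc k)
  note inv = Suc.IH[OF Ck_on_SucD[OF Suc.prems]]
  note mult = Ck_on_bilinear[OF bounded_bilinear_mult \<open>open S\<close>]
  show ?case
  proof (rule Ck_on_SucI[OF \<open>open S\<close>])
    show "((\<lambda>p. inverse (f p)) has_derivative
        (\<lambda>v. - (inverse (f p) * frechet_derivative f (at p) v * inverse (f p)))) (at p)"
      if "p \<in> S" for p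
      using Suc.prems that assms(3) by (intro Deriv.has_derivative_inverse Ck_on_Suc_has_derivative)
    show "Ck_on k S (\<lambda>p. - (inverse (f p) * frechet_derivative f (at p) v * inverse (f p)))" for v
      using Suc.prems
      by (intro Ck_on_bounded_linear[OF bounded_linear_minus[OF bounded_linear_ident]] mult inv
          \<open>open S\<close>) auto
  qed
qed

lemma Ck_on_sum:
  assumes "open S" "finite I" "\<And>i. i \<in> I \<Longrightarrow> Ck_on k S (f i)"
  shows "Ck_on k S (\<lambda>p. \<Sum>i\<in>I. f i p)"
  using assms(2,3)
proof (induction I)
  case empty
  then show ?case by (simp add: Ck_on_const \<open>open S\<close>)
next
  case (insert i I)
  then show ?case by (simp add: Ck_on_add \<open>open S\<close>)
qed

text \<open>\<open>Dg(f(p))\<close> is applied to the vector \<open>Df(p)v\<close>, which varies with \<open>p\<close>, whereas \<^const>\<open>Ck_on\<close> only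
  speaks of derivatives in fixed directions. Expanding \<open>Df(p)v\<close> in a basis leaves fixed directions
  with \<open>C\<^sup>k\<close> coefficients, to which the induction hypothesis applies; this is why the middle space
  has finite dimension.\<close>

lemma Ck_on_compose:
  fixes f :: "'a::real_normed_vector \<Rightarrow> 'b::euclidean_space"
  assumes "open S" "open T" "f ` S \<subseteq> T" "Ck_on k S f" "Ck_on k T g"
  shows "Ck_on k S (\<lambda>p. g (f p))"
  using assms(4,5)
proof (induction k arbitrary: g)
  case 0
  then show ?case using continuous_on_compose2[OF _ _ \<open>f ` S \<subseteq> T\<close>] by auto
next
  case (Suc k)
  let ?f' = "\<lambda>p. frechet_derivative f (at p)" and ?g' = "\<lambda>q. frechet_derivative g (at q)"
  have g': "(g has_derivative ?g' (f p)) (at (f p))" if "p \<in> S" for p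
    using Suc.prems \<open>f ` S \<subseteq> T\<close> that by (intro Ck_on_Suc_has_derivative) auto
  show ?case
  proof (rule Ck_on_SucI[OF \<open>open S\<close>])
    show "((\<lambda>p. g (f p)) has_derivative (\<lambda>v. \<Sum>b\<in>Basis. (?f' p v \<bullet> b) *\<^sub>R ?g' (f p) b)) (at p)"
      if "p \<in> S" for p
    proof -
      have chain: "((\<lambda>p. g (f p)) has_derivative (\<lambda>v. ?g' (f p) (?f' p v))) (at p)"
        using has_derivative_compose[OF Ck_on_Suc_has_derivative[OF Suc.prems(1) that] g'[OF that]] .
      have expand: "?g' (f p) u = (\<Sum>b\<in>Basis. (u \<bullet> b) *\<^sub>R ?g' (f p) b)" for u
      proof -
        interpret bounded_linear "?g' (f p)"
          using g'[OF that] by (rule has_derivative_bounded_linear)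
        have "?g' (f p) u = ?g' (f p) (\<Sum>b\<in>Basis. (u \<bullet> b) *\<^sub>R b)"
          by (simp add: euclidean_representation)
        then show ?thesis by (simp add: sum scale)
      qed
      show ?thesis
        using chain by (rule has_derivative_eq_rhs) (rule ext, rule expand)
    qed
    have "Ck_on k S (\<lambda>p. ?g' (f p) b)" for b
      using Suc.IH[of "\<lambda>q. ?g' q b"] Suc.prems Ck_on_SucD[OF Suc.prems(1)] by auto
    moreover have "Ck_on k S (\<lambda>p. ?f' p v \<bullet> b)" for v b
      using Suc.prems by (intro Ck_on_bounded_linear[OF bounded_linear_inner_left] \<open>open S\<close>) auto
    ultimately show "Ck_on k S (\<lambda>p. \<Sum>b\<in>Basis. (?f' p v \<bullet> b) *\<^sub>R ?g' (f p) b)" for v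
      by (intro Ck_on_sum Ck_on_bilinear[OF bounded_bilinear_scaleR] \<open>open S\<close>) auto
  qed
qed

lemma Ck_on_vec:
  fixes f :: "'a::real_normed_vector \<Rightarrow> 'b::euclidean_space ^ 'n"
  assumes "open S" "\<And>i. Ck_on k S (\<lambda>p. f p $ i)"
  shows "Ck_on k S f"
proof -
  have lin: "bounded_linear (\<lambda>c::'b. axis i c :: 'b^'n)" for i
    unfolding linear_conv_bounded_linear[symmetric]
    by (intro linearI) (simp_all add: axis_def vec_eq_iff)
  have "Ck_on k S (\<lambda>p. \<Sum>i\<in>UNIV. axis i (f p $ i))"
    by (intro Ck_on_sum Ck_on_bounded_linear[OF lin] assms) auto
  moreover have "(\<Sum>i\<in>UNIV. axis i (f p $ i)) = f p" for p
    by (simp add: vec_eq_iff axis_def)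
  ultimately show ?thesis by simp
qed

lemma smooth_on_subset: "smooth_on S f \<Longrightarrow> T \<subseteq> S \<Longrightarrow> smooth_on T f"
  unfolding smooth_on_def by (intro allI Ck_on_subset[of _ S f T]) simp_all

lemma smooth_on_cong:
  "open S \<Longrightarrow> smooth_on S f \<Longrightarrow> (\<And>p. p \<in> S \<Longrightarrow> f p = g p) \<Longrightarrow> smooth_on S g"
  unfolding smooth_on_def by (intro allI Ck_on_cong[of S _ f g]) simp_all

lemma smooth_on_has_derivative:
  "smooth_on S f \<Longrightarrow> p \<in> S \<Longrightarrow> (f has_derivative frechet_derivative f (at p)) (at p)"
  by (rule Ck_on_Suc_has_derivative[of 0 S]) (simp_all only: smooth_on_def)

lemma smooth_on_differentiable: "smooth_on S f \<Longrightarrow> p \<in> S \<Longrightarrow> f differentiable (at p)"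
  by (rule differentiableI[OF smooth_on_has_derivative])

lemma smooth_on_imp_continuous_on: "smooth_on S f \<Longrightarrow> continuous_on S f"
  unfolding smooth_on_def by (drule spec[of _ 0]) simp

lemma smooth_on_directional_derivative:
  "smooth_on S f \<Longrightarrow> smooth_on S (\<lambda>p. frechet_derivative f (at p) v)"
  unfolding smooth_on_def
proof (rule allI)
  fix k assume "\<forall>k. Ck_on k S f"
  then have "Ck_on (Suc k) S f" ..
  then show "Ck_on k S (\<lambda>p. frechet_derivative f (at p) v)" by simp
qed

lemma smooth_on_const: "open S \<Longrightarrow> smooth_on S (\<lambda>p. c)"
  by (simp add: smooth_on_def Ck_on_const)

lemma smooth_on_ident: "open S \<Longrightarrow> smooth_on S (\<lambda>p. p)"
  by (simp add: smooth_on_def Ck_on_ident)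

lemma smooth_on_bounded_linear:
  "bounded_linear L \<Longrightarrow> open S \<Longrightarrow> smooth_on S f \<Longrightarrow> smooth_on S (\<lambda>p. L (f p))"
  by (simp add: smooth_on_def Ck_on_bounded_linear)

lemma smooth_on_linear:
  fixes L :: "'a::euclidean_space \<Rightarrow> 'b::real_normed_vector"
  shows "linear L \<Longrightarrow> open S \<Longrightarrow> smooth_on S L"
  using smooth_on_bounded_linear[of L S "\<lambda>p. p"]
  by (simp add: smooth_on_ident linear_conv_bounded_linear)

lemma smooth_on_nth: "open S \<Longrightarrow> smooth_on S f \<Longrightarrow> smooth_on S (\<lambda>p. f p $ i)"
  by (rule smooth_on_bounded_linear[OF bounded_linear_vec_nth])

lemma smooth_on_minus: "open S \<Longrightarrow> smooth_on S f \<Longrightarrow> smooth_on S (\<lambda>p. - f p)"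
  by (rule smooth_on_bounded_linear[OF bounded_linear_minus[OF bounded_linear_ident]])

lemma smooth_on_add:
  "open S \<Longrightarrow> smooth_on S f \<Longrightarrow> smooth_on S g \<Longrightarrow> smooth_on S (\<lambda>p. f p + g p)"
  by (simp add: smooth_on_def Ck_on_add)

lemma smooth_on_diff:
  "open S \<Longrightarrow> smooth_on S f \<Longrightarrow> smooth_on S g \<Longrightarrow> smooth_on S (\<lambda>p. f p - g p)"
  using smooth_on_add[of S f "\<lambda>p. - g p"] by (simp add: smooth_on_minus)

lemma smooth_on_mult:
  fixes f g :: "'a::real_normed_vector \<Rightarrow> real"
  shows "open S \<Longrightarrow> smooth_on S f \<Longrightarrow> smooth_on S g \<Longrightarrow> smooth_on S (\<lambda>p. f p * g p)"
  by (simp add: smooth_on_def Ck_on_bilinear[OF bounded_bilinear_mult])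

lemma smooth_on_divide:
  fixes f g :: "'a::real_normed_vector \<Rightarrow> real"
  assumes "open S" "smooth_on S f" "smooth_on S g" "\<And>p. p \<in> S \<Longrightarrow> g p \<noteq> 0"
  shows "smooth_on S (\<lambda>p. f p / g p)"
proof -
  have "smooth_on S (\<lambda>p. f p * inverse (g p))"
    using assms by (intro smooth_on_mult) (auto simp: smooth_on_def intro: Ck_on_inverse)
  then show ?thesis by (simp add: divide_inverse)
qed

lemma smooth_on_sum:
  "open S \<Longrightarrow> finite I \<Longrightarrow> (\<And>i. i \<in> I \<Longrightarrow> smooth_on S (f i)) \<Longrightarrow> smooth_on S (\<lambda>p. \<Sum>i\<in>I. f i p)"
  by (simp add: smooth_on_def Ck_on_sum)

lemma smooth_on_prod:
  fixes f :: "'i \<Rightarrow> 'a::real_normed_vector \<Rightarrow> real"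
  assumes "open S" "finite I" "\<And>i. i \<in> I \<Longrightarrow> smooth_on S (f i)"
  shows "smooth_on S (\<lambda>p. \<Prod>i\<in>I. f i p)"
  using assms(2,3)
  by (induction I) (simp_all add: smooth_on_const smooth_on_mult \<open>open S\<close>)

lemma smooth_on_compose:
  fixes f :: "'a::real_normed_vector \<Rightarrow> 'b::euclidean_space"
  shows "open S \<Longrightarrow> open T \<Longrightarrow> f ` S \<subseteq> T \<Longrightarrow> smooth_on S f \<Longrightarrow> smooth_on T g
    \<Longrightarrow> smooth_on S (\<lambda>p. g (f p))"
  unfolding smooth_on_def by (intro allI Ck_on_compose[of S T f _ g]) simp_all

lemma smooth_on_vec:
  fixes f :: "'a::real_normed_vector \<Rightarrow> 'b::euclidean_space ^ 'n"
  shows "open S \<Longrightarrow> (\<And>i. smooth_on S (\<lambda>p. f p $ i)) \<Longrightarrow> smooth_on S f"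
  by (simp add: smooth_on_def Ck_on_vec)

lemma smooth_on_det:
  fixes A :: "'a::real_normed_vector \<Rightarrow> real^'n^'n"
  assumes "open S" "\<And>i j. smooth_on S (\<lambda>p. A p $ i $ j)"
  shows "smooth_on S (\<lambda>p. det (A p))"
  unfolding det_def
  by (intro smooth_on_sum smooth_on_mult smooth_on_prod smooth_on_const assms) auto

section \<open>The smooth inverse function theorem\<close>

text \<open>The \<open>C\<^sup>1\<close> theorem gives a local inverse \<open>g\<close> with \<open>Dg(y) = (Df(g(y)))\<inverse>\<close>. By Cramer's rule
  \<open>q \<mapsto> (Df(q))\<inverse> v\<close> is smooth, so if \<open>g\<close> is \<open>C\<^sup>k\<close> then its derivative is \<open>C\<^sup>k\<close> as a composition, and \<open>g\<close>
  is \<open>C\<^sup>k\<^sup>+\<^sup>1\<close>.\<close>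

theorem smooth_inverse_function_theorem:
  fixes f :: "real^'n \<Rightarrow> real^'n"
  assumes "open U" "smooth_on U f" "p \<in> U" and inj: "inj (frechet_derivative f (at p))"
  obtains A B g where "open A" "A \<subseteq> U" "p \<in> A" "open B" "homeomorphism A B f g" "smooth_on B g"
proof -
  let ?f' = "\<lambda>q. frechet_derivative f (at q)"
  have f': "(f has_derivative ?f' q) (at q)" if "q \<in> U" for q
    using assms(2) that by (rule smooth_on_has_derivative)
  have bl: "bounded_linear (?f' q)" if "q \<in> U" for q
    using f'[OF that] by (rule has_derivative_bounded_linear)
  have app: "blinfun_apply (Blinfun (?f' q)) = ?f' q" if "q \<in> U" for q
    by (rule bounded_linear_Blinfun_apply[OF bl[OF that]])
  have cont: "continuous_on U (\<lambda>q. Blinfun (?f' q))"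
  proof (rule continuous_on_blinfun_componentwise)
    show "continuous_on U (\<lambda>q. blinfun_apply (Blinfun (?f' q)) v)" for v
      using smooth_on_imp_continuous_on[OF smooth_on_directional_derivative[OF assms(2), of v]] app
      by (simp cong: continuous_on_cong)
  qed
  have der: "(f has_derivative blinfun_apply (Blinfun (?f' q))) (at q)" if "q \<in> U" for q
    using f'[OF that] by (simp only: app[OF that])
  obtain L where L: "linear L" "L \<circ> ?f' p = id"
    using linear_injective_left_inverse[OF bounded_linear.linear[OF bl[OF \<open>p \<in> U\<close>]] inj] by blast
  have left: "Blinfun L o\<^sub>L Blinfun (?f' p) = id_blinfun"
    using L by (intro blinfun_eqI)
      (simp add: app[OF \<open>p \<in> U\<close>] bounded_linear_Blinfun_apply linear_conv_bounded_linear pointfree_idE)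
  obtain A B g g' where AB: "open A" "A \<subseteq> U" "p \<in> A" "open B" "homeomorphism A B f g"
    and g': "\<And>y. y \<in> B \<Longrightarrow> (g has_derivative g' y) (at y)"
      "\<And>y. y \<in> B \<Longrightarrow> g' y = inv (blinfun_apply (Blinfun (?f' (g y))))"
      "\<And>y. y \<in> B \<Longrightarrow> bij (blinfun_apply (Blinfun (?f' (g y))))"
    using inverse_function_theorem[OF \<open>open U\<close> der cont \<open>p \<in> U\<close> left] by metis
  have gA: "g ` B \<subseteq> A" and Bg: "B \<subseteq> f ` A"
    using AB(5) by (auto simp: homeomorphism_def)
  define J where "J q = matrix (?f' q)" for q
  \<comment> \<open>The solution \<open>G v q\<close> of \<open>Df(q) u = v\<close> given by Cramer's rule: its components are quotients of determinants.\<close>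
  define G where "G v q = (\<chi> k. det (\<chi> i j. if j = k then v $ i else J q $ i $ j) / det (J q))"
    for v q
  have J: "?f' q = (*v) (J q)" if "q \<in> U" for q
    using bl[OF that] by (auto simp: J_def fun_eq_iff bounded_linear.linear)
  have sJ: "smooth_on A (\<lambda>q. J q $ i $ j)" for i j
  proof -
    have "smooth_on A (\<lambda>q. ?f' q (axis j 1) $ i)"
      using smooth_on_subset[OF assms(2) \<open>A \<subseteq> U\<close>] \<open>open A\<close>
      by (intro smooth_on_nth smooth_on_directional_derivative)
    then show ?thesis by (simp add: J_def matrix_def)
  qed
  have bij: "bij (?f' q)" if "q \<in> A" for q
  proof -
    have "f q \<in> B" "g (f q) = q"
      using AB(5) that by (auto simp: homeomorphism_def)
    then show ?thesis using g'(3)[of "f q"] app[of q] that \<open>A \<subseteq> U\<close> by auto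
  qed
  have det: "det (J q) \<noteq> 0" if "q \<in> A" for q
  proof -
    have "inj ((*v) (J q))"
      using bij[OF that] J[of q] that \<open>A \<subseteq> U\<close> by (metis bij_def subsetD)
    then show ?thesis
      by (metis invertible_det_nz invertible_left_inverse matrix_left_invertible_injective)
  qed
  have G: "inv (?f' q) v = G v q" if "q \<in> A" for q v
  proof (rule inv_f_eq)
    show "inj (?f' q)" using bij[OF that] by (rule bij_is_inj)
    show "?f' q (G v q) = v"
      using cramer[OF det[OF that], of "G v q" v] J that \<open>A \<subseteq> U\<close> by (auto simp: G_def)
  qed
  have sG: "smooth_on A (G v)" for v
  proof (rule smooth_on_vec[OF \<open>open A\<close>])
    fix k
    have "smooth_on A (\<lambda>q. (\<chi> i j. if j = k then v $ i else J q $ i $ j) $ i $ j)" for i j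
      using sJ \<open>open A\<close> by (cases "j = k") (auto intro: smooth_on_const)
    then show "smooth_on A (\<lambda>q. G v q $ k)"
      unfolding G_def vec_lambda_beta
      by (intro smooth_on_divide smooth_on_det sJ det \<open>open A\<close>) auto
  qed
  have "Ck_on k B g" for k
  proof (induction k)
    case 0
    show ?case using AB(5) by (simp add: homeomorphism_def)
  next
    case (Suc k)
    show ?case
    proof (rule Ck_on_SucI[OF \<open>open B\<close>])
      show "(g has_derivative (\<lambda>v. G v (g y))) (at y)" if "y \<in> B" for y
      proof -
        have "g y \<in> A" using gA that by auto
        then have "g' y = inv (?f' (g y))"
          using g'(2)[OF that] app[of "g y"] \<open>A \<subseteq> U\<close> by auto
        then have "g' y = (\<lambda>v. G v (g y))"
          using G[OF \<open>g y \<in> A\<close>] by (simp add: fun_eq_iff)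
        then show ?thesis using g'(1)[OF that] by simp
      qed
      show "Ck_on k B (\<lambda>y. G v (g y))" for v
        using sG[of v] by (intro Ck_on_compose[OF \<open>open B\<close> \<open>open A\<close> gA Suc]) (simp add: smooth_on_def)
    qed
  qed
  then show ?thesis using that AB by (simp add: smooth_on_def)
qed

section \<open>Symmetry of second derivatives\<close>

text \<open>The second difference of \<open>g\<close> over a parallelogram, read as the increment in direction \<open>a\<close> of the
  increment in direction \<open>b\<close>: two uses of the mean value theorem turn it into a second
  derivative. Its left-hand side is symmetric in \<open>a\<close> and \<open>b\<close>, the right-hand side is not visibly so.\<close>

lemma second_difference_mean_value:
  fixes g :: "'a::real_normed_vector \<Rightarrow> real"
  assumes "Ck_on (Suc (Suc 0)) S g" "0 < s"
    and S: "\<And>\<sigma> \<tau>. 0 \<le> \<sigma> \<Longrightarrow> \<sigma> \<le> s \<Longrightarrow> 0 \<le> \<tau> \<Longrightarrow> \<tau> \<le> s \<Longrightarrow> p + \<sigma> *\<^sub>R a + \<tau> *\<^sub>R b \<in> S"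
  obtains \<sigma> \<tau> where "0 < \<sigma>" "\<sigma> < s" "0 < \<tau>" "\<tau> < s"
    "g (p + s *\<^sub>R a + s *\<^sub>R b) - g (p + s *\<^sub>R a) - (g (p + s *\<^sub>R b) - g p)
      = s * (s * frechet_derivative (\<lambda>q. frechet_derivative g (at q) a) (at (p + \<sigma> *\<^sub>R a + \<tau> *\<^sub>R b)) b)"
proof -
  let ?a = "\<lambda>q. frechet_derivative g (at q) a"
  have D: "((\<lambda>t. G (c + t *\<^sub>R v)) has_real_derivative frechet_derivative G (at (c + t *\<^sub>R v)) v) (at t)"
    if "Ck_on (Suc 0) S G" "c + t *\<^sub>R v \<in> S" for G :: "'a \<Rightarrow> real" and c v t
  proof -
    interpret bounded_linear "frechet_derivative G (at (c + t *\<^sub>R v))"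
      using Ck_on_Suc_has_derivative[OF that] by (rule has_derivative_bounded_linear)
    have "((\<lambda>t. c + t *\<^sub>R v) has_derivative (\<lambda>t. t *\<^sub>R v)) (at t)"
      by (auto intro!: derivative_eq_intros)
    from has_derivative_compose[OF this Ck_on_Suc_has_derivative[OF that]]
    show ?thesis
      by (simp add: has_field_derivative_def scale mult_commute_abs)
  qed
  have g: "Ck_on (Suc 0) S g" "Ck_on (Suc 0) S ?a"
    using Ck_on_SucD[OF assms(1)] assms(1) by simp_all
  have S0: "p + \<sigma> *\<^sub>R a \<in> S" "p + \<sigma> *\<^sub>R b \<in> S" if "0 \<le> \<sigma>" "\<sigma> \<le> s" for \<sigma>
    using S[of \<sigma> 0] S[of 0 \<sigma>] that by auto
  have "\<exists>\<sigma>>0. \<sigma> < s \<and>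
      (g (p + s *\<^sub>R b + s *\<^sub>R a) - g (p + s *\<^sub>R a)) - (g (p + s *\<^sub>R b + 0 *\<^sub>R a) - g (p + 0 *\<^sub>R a))
      = (s - 0) * (?a (p + s *\<^sub>R b + \<sigma> *\<^sub>R a) - ?a (p + \<sigma> *\<^sub>R a))"
  proof (rule MVT2[OF \<open>0 < s\<close>])
    show "((\<lambda>t. g (p + s *\<^sub>R b + t *\<^sub>R a) - g (p + t *\<^sub>R a)) has_real_derivative
        ?a (p + s *\<^sub>R b + t *\<^sub>R a) - ?a (p + t *\<^sub>R a)) (at t)" if "0 \<le> t" "t \<le> s" for t
      using S[of t s] S0 that \<open>0 < s\<close> by (intro DERIV_diff D g) (auto simp: algebra_simps)
  qed
  then obtain \<sigma> where \<sigma>: "0 < \<sigma>" "\<sigma> < s"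
      "g (p + s *\<^sub>R a + s *\<^sub>R b) - g (p + s *\<^sub>R a) - (g (p + s *\<^sub>R b) - g p)
        = s * (?a (p + \<sigma> *\<^sub>R a + s *\<^sub>R b) - ?a (p + \<sigma> *\<^sub>R a + 0 *\<^sub>R b))"
    by (auto simp: algebra_simps)
  have "\<exists>\<tau>>0. \<tau> < s \<and> ?a (p + \<sigma> *\<^sub>R a + s *\<^sub>R b) - ?a (p + \<sigma> *\<^sub>R a + 0 *\<^sub>R b)
      = (s - 0) * frechet_derivative ?a (at (p + \<sigma> *\<^sub>R a + \<tau> *\<^sub>R b)) b"
  proof (rule MVT2[OF \<open>0 < s\<close>])
    show "((\<lambda>t. ?a (p + \<sigma> *\<^sub>R a + t *\<^sub>R b)) has_real_derivative
        frechet_derivative ?a (at (p + \<sigma> *\<^sub>R a + t *\<^sub>R b)) b) (at t)" if "0 \<le> t" "t \<le> s" for t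
      using S[of \<sigma> t] that \<sigma> by (intro D g) auto
  qed
  then show ?thesis using \<sigma> that by auto
qed

text \<open>Both mixed derivatives are limits of the same second difference divided by \<open>s\<^sup>2\<close>, as the
  parallelogram shrinks to \<open>p\<close>.\<close>

lemma directional_derivatives_commute_real:
  fixes g :: "'a::real_normed_vector \<Rightarrow> real"
  assumes "open S" "Ck_on (Suc (Suc 0)) S g" "p \<in> S"
  shows "frechet_derivative (\<lambda>q. frechet_derivative g (at q) a) (at p) b
    = frechet_derivative (\<lambda>q. frechet_derivative g (at q) b) (at p) a"
    (is "?ab p = ?ba p")
proof -
  have "isCont ?ab p" "isCont ?ba p"
    using assms by (auto simp: continuous_on_eq_continuous_at)
  then have cont: "(?ab \<longlongrightarrow> ?ab p) (nhds p)" "(?ba \<longlongrightarrow> ?ba p) (nhds p)"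
    unfolding isCont_def
    using tendsto_at_iff_tendsto_nhds[of ?ab p] tendsto_at_iff_tendsto_nhds[of ?ba p] by auto
  have "dist (?ab p) (?ba p) < e" if "0 < e" for e
  proof -
    obtain d where d: "0 < d" "\<And>q. dist q p < d \<Longrightarrow> q \<in> S"
        "\<And>q. dist q p < d \<Longrightarrow> dist (?ab q) (?ab p) < e / 2"
        "\<And>q. dist q p < d \<Longrightarrow> dist (?ba q) (?ba p) < e / 2"
    proof -
      have "\<forall>\<^sub>F q in nhds p. q \<in> S \<and> dist (?ab q) (?ab p) < e / 2 \<and> dist (?ba q) (?ba p) < e / 2"
        using cont \<open>0 < e\<close> assms(1,3)
        by (intro eventually_conj eventually_nhds_in_open tendstoD) auto
      then show ?thesis using that by (auto simp: eventually_nhds_metric)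
    qed
    define c where "c = norm a + norm b + 1"
    have "0 < c" by (simp add: c_def add_nonneg_pos)
    \<comment> \<open>The sides \<open>s a\<close> and \<open>s b\<close> are so short that the whole parallelogram lies within \<open>d\<close> of \<open>p\<close>.\<close>
    define s where "s = d / (2 * c)"
    have "0 < s" using \<open>0 < d\<close> \<open>0 < c\<close> by (simp add: s_def)
    have near: "dist (p + \<sigma> *\<^sub>R a + \<tau> *\<^sub>R b) p < d" if "0 \<le> \<sigma>" "\<sigma> \<le> s" "0 \<le> \<tau>" "\<tau> \<le> s" for \<sigma> \<tau>
    proof -
      have "dist (p + \<sigma> *\<^sub>R a + \<tau> *\<^sub>R b) p \<le> \<sigma> * norm a + \<tau> * norm b"
        using that norm_triangle_ineq[of "\<sigma> *\<^sub>R a" "\<tau> *\<^sub>R b"]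
        by (simp add: dist_norm add.assoc)
      also have "\<dots> \<le> s * c"
        using that mult_right_mono[of \<sigma> s "norm a"] mult_right_mono[of \<tau> s "norm b"]
        by (simp add: c_def algebra_simps)
      also have "\<dots> = d / 2"
        using \<open>0 < c\<close> by (simp add: s_def)
      finally show ?thesis using \<open>0 < d\<close> by simp
    qed
    have near': "dist (p + \<sigma> *\<^sub>R b + \<tau> *\<^sub>R a) p < d" if "0 \<le> \<sigma>" "\<sigma> \<le> s" "0 \<le> \<tau>" "\<tau> \<le> s" for \<sigma> \<tau>
      using near[of \<tau> \<sigma>] that by (simp add: ac_simps)
    obtain \<sigma> \<tau> where 1: "0 < \<sigma>" "\<sigma> < s" "0 < \<tau>" "\<tau> < s"
      "g (p + s *\<^sub>R a + s *\<^sub>R b) - g (p + s *\<^sub>R a) - (g (p + s *\<^sub>R b) - g p)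
        = s * (s * ?ab (p + \<sigma> *\<^sub>R a + \<tau> *\<^sub>R b))"
      using second_difference_mean_value[OF assms(2) \<open>0 < s\<close>, of p a b] near d(2) by metis
    obtain \<sigma>' \<tau>' where 2: "0 < \<sigma>'" "\<sigma>' < s" "0 < \<tau>'" "\<tau>' < s"
      "g (p + s *\<^sub>R b + s *\<^sub>R a) - g (p + s *\<^sub>R b) - (g (p + s *\<^sub>R a) - g p)
        = s * (s * ?ba (p + \<sigma>' *\<^sub>R b + \<tau>' *\<^sub>R a))"
      using second_difference_mean_value[OF assms(2) \<open>0 < s\<close>, of p b a] near' d(2) by metis
    have "s * (s * ?ab (p + \<sigma> *\<^sub>R a + \<tau> *\<^sub>R b)) = s * (s * ?ba (p + \<tau>' *\<^sub>R a + \<sigma>' *\<^sub>R b))"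
      using 1(5) 2(5) by (simp add: algebra_simps)
    then have "?ab (p + \<sigma> *\<^sub>R a + \<tau> *\<^sub>R b) = ?ba (p + \<tau>' *\<^sub>R a + \<sigma>' *\<^sub>R b)"
      using \<open>0 < s\<close> by simp
    moreover have "dist (?ab (p + \<sigma> *\<^sub>R a + \<tau> *\<^sub>R b)) (?ab p) < e / 2"
      using 1 by (intro d(3) near) auto
    moreover have "dist (?ba (p + \<tau>' *\<^sub>R a + \<sigma>' *\<^sub>R b)) (?ba p) < e / 2"
      using 2 by (intro d(4) near) auto
    ultimately show ?thesis by (metis dist_commute dist_triangle_half_l)
  qed
  then show ?thesis by (metis dist_nz less_irrefl)
qed

text \<open>Vector-valued maps are reduced to their inner products with fixed vectors.\<close>

lemma directional_derivatives_commute: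
  fixes f :: "'a::real_normed_vector \<Rightarrow> 'b::real_inner"
  assumes "open S" "smooth_on S f" "p \<in> S"
  shows "frechet_derivative (\<lambda>q. frechet_derivative f (at q) a) (at p) b
    = frechet_derivative (\<lambda>q. frechet_derivative f (at q) b) (at p) a"
proof (rule vector_eq_rdot[THEN iffD1], intro allI)
  fix c :: 'b
  have inner: "frechet_derivative (\<lambda>q. F q \<bullet> c) (at q) v = frechet_derivative F (at q) v \<bullet> c"
    if "smooth_on S F" "q \<in> S" for F :: "'a \<Rightarrow> 'b" and q v
    using has_derivative_inner_left[OF smooth_on_has_derivative[OF that], of c]
    by (metis frechet_derivative_at)
  let ?g = "\<lambda>q. f q \<bullet> c"
  have twice: "frechet_derivative (\<lambda>q. frechet_derivative ?g (at q) u) (at p) v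
      = frechet_derivative (\<lambda>q. frechet_derivative f (at q) u) (at p) v \<bullet> c" for u v
  proof -
    note f'u = smooth_on_directional_derivative[OF assms(2), of u]
    have "((\<lambda>q. frechet_derivative ?g (at q) u) has_derivative
        (\<lambda>v. frechet_derivative (\<lambda>q. frechet_derivative f (at q) u) (at p) v \<bullet> c)) (at p)"
      using has_derivative_inner_left[OF smooth_on_has_derivative[OF f'u \<open>p \<in> S\<close>], of c]
      by (rule has_derivative_transform_within_open[OF _ \<open>open S\<close> \<open>p \<in> S\<close>])
        (simp add: inner[OF assms(2)])
    then show ?thesis by (metis frechet_derivative_at)
  qed
  have "smooth_on S ?g"
    using assms by (intro smooth_on_bounded_linear[OF bounded_linear_inner_left])
  then show "frechet_derivative (\<lambda>q. frechet_derivative f (at q) a) (at p) b \<bullet> c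
    = frechet_derivative (\<lambda>q. frechet_derivative f (at q) b) (at p) a \<bullet> c"
    using directional_derivatives_commute_real[OF \<open>open S\<close> _ \<open>p \<in> S\<close>, of ?g a b]
    by (simp add: twice smooth_on_def del: Ck_on.simps)
qed

section \<open>The moving basis of a map in normal form\<close>

text \<open>\<open>A\<^sup>TAv = 0\<close> implies \<open>|Av|\<^sup>2 = v \<bullet> A\<^sup>TAv = 0\<close>.\<close>

lemma invertible_gram_matrix:
  fixes A :: "real^'n^'m"
  assumes "\<And>v. A *v v = 0 \<Longrightarrow> v = 0"
  shows "invertible (transpose A ** A)"
proof -
  have "v = 0" if "(transpose A ** A) *v v = 0" for v
  proof -
    have "v \<bullet> (transpose A *v (A *v v)) = 0"
      using that by (simp add: matrix_vector_mul_assoc)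
    then have "(A *v v) \<bullet> (A *v v) = 0"
      by (simp add: dot_lmul_matrix flip: vector_transpose_matrix)
    then show "v = 0" using assms by simp
  qed
  then show ?thesis
    by (simp add: invertible_left_inverse matrix_left_invertible_ker)
qed

text \<open>The equation \<open>Dx = \<Omega> D\<close> determines \<open>D\<close> when \<open>\<Omega>\<close> has independent columns, because
  \<open>(\<Omega>\<^sup>T\<Omega>)\<inverse>\<Omega>\<^sup>T\<close> is a left inverse of \<open>\<Omega>\<close>; so \<open>\<Lambda>\<close> can be read off any such factorization.\<close>

lemma tmb_Lambda_eq_transpose:
  assumes "\<And>v. \<Omega> p *v v = 0 \<Longrightarrow> v = 0" and "jacobian x (at p) = \<Omega> p ** D"
  shows "tmb_Lambda x \<Omega> p = transpose D"
proof -
  let ?G = "transpose (\<Omega> p) ** \<Omega> p"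
  have "tmb_Lambda x \<Omega> p = transpose D ** (?G ** matrix_inv ?G)"
    by (simp add: tmb_Lambda_def assms(2) matrix_transpose_mul matrix_mul_assoc)
  moreover have "invertible ?G"
    using assms(1) by (rule invertible_gram_matrix)
  then have "?G ** matrix_inv ?G = mat 1"
    unfolding invertible_def matrix_inv_def by (rule someI_ex[THEN conjunct1])
  ultimately show ?thesis by simp
qed

lemma column_jacobian: "column j (jacobian f (at p)) = frechet_derivative f (at p) (axis j 1)"
  by (simp add: column_def jacobian_def matrix_def vec_eq_iff)

lemma frechet_derivative_nth:
  fixes f :: "'a::real_normed_vector \<Rightarrow> real^'n"
  assumes "f differentiable (at p)"
  shows "frechet_derivative (\<lambda>q. f q $ i) (at p) v = frechet_derivative f (at p) v $ i"
proof -
  have "((\<lambda>q. f q $ i) has_derivative (\<lambda>v. frechet_derivative f (at p) v $ i)) (at p)"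
    using assms by (intro bounded_linear.has_derivative[OF bounded_linear_vec_nth])
      (simp add: frechet_derivative_works)
  then show ?thesis by (metis frechet_derivative_at)
qed

lemma adapted_basis_component:
  "adapted_basis y p $ i $ 1 = frechet_derivative y (at p) (axis 1 1) $ i"
  "adapted_basis y p $ i $ 2 = (vector [0, 1, p $ 2] :: real^3) $ i"
  by (simp_all add: adapted_basis_def transpose_def column_jacobian)

lemma adapted_basis_column:
  "column 1 (adapted_basis y p) = frechet_derivative y (at p) (axis 1 1)"
  "column 2 (adapted_basis y p) = vector [0, 1, p $ 2]"
  by (simp_all add: column_def adapted_basis_component)

lemma adapted_basis_inj:
  assumes "frechet_derivative y (at p) (axis 1 1) $ 1 = 1" "adapted_basis y p *v v = 0"
  shows "v = 0"
proof -
  have "(adapted_basis y p *v v) $ i = 0" for i using assms(2) by simp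
  from this[of 1] this[of 2] show "v = 0"
    by (simp add: matrix_vector_mult_def sum_2 adapted_basis_component assms(1) vec_eq_iff forall_2)
qed

lemma smooth_on_adapted_basis:
  assumes "open V" "smooth_on V y"
  shows "smooth_on V (adapted_basis y)"
proof (intro smooth_on_vec \<open>open V\<close>)
  fix i :: 3 and j :: 2
  have "smooth_on V (\<lambda>p. frechet_derivative y (at p) (axis 1 1) $ i)"
    by (intro smooth_on_nth smooth_on_directional_derivative assms)
  moreover have "smooth_on V (\<lambda>p. (vector [0, 1, p $ 2] :: real^3) $ i)"
    using exhaust_3[of i] smooth_on_const[OF \<open>open V\<close>]
      smooth_on_nth[OF \<open>open V\<close> smooth_on_ident[OF \<open>open V\<close>]]
    by auto
  ultimately show "smooth_on V (\<lambda>p. adapted_basis y p $ i $ j)"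
    using exhaust_2[of j] by (auto simp: adapted_basis_component)
qed

text \<open>The hypotheses say that \<open>Dy\<close> is the adapted basis times \<open>diag(1, l)\<close>. The columns are independent
  since their first components are \<open>1\<close> and \<open>0\<close>, and the second column does not vanish.\<close>

lemma adapted_basis_is_tangent_moving_basis:
  assumes V: "open V" "smooth_on V y"
    and w: "\<And>p. p \<in> V \<Longrightarrow> frechet_derivative y (at p) (axis 1 1) $ 1 = 1"
    and z: "\<And>p. p \<in> V \<Longrightarrow> frechet_derivative y (at p) (axis 2 1) = l p *\<^sub>R vector [0, 1, p $ 2]"
  shows "tangent_moving_basis V y (adapted_basis y)"
    and "\<And>p. p \<in> V \<Longrightarrow> tmb_Lambda y (adapted_basis y) p = vector [vector [1, 0], vector [0, l p]]"
    and "\<And>p. p \<in> V \<Longrightarrow> tmb_lambda y (adapted_basis y) p = l p"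
proof -
  show Lambda: "tmb_Lambda y (adapted_basis y) p = vector [vector [1, 0], vector [0, l p]]"
    if "p \<in> V" for p
  proof -
    let ?D = "vector [vector [1, 0], vector [0, l p]] :: real^2^2"
    have "jacobian y (at p) $ i $ j = (adapted_basis y p ** ?D) $ i $ j" for i j
      using arg_cong[OF column_jacobian[of j y p], of "\<lambda>c. c $ i"] exhaust_2[of j] z[OF that]
      by (auto simp: column_def matrix_matrix_mult_def sum_2 adapted_basis_component)
    then have "jacobian y (at p) = adapted_basis y p ** ?D"
      by (simp add: vec_eq_iff)
    then have "tmb_Lambda y (adapted_basis y) p = transpose ?D"
      using adapted_basis_inj[OF w[OF that]] by (intro tmb_Lambda_eq_transpose)
    also have "transpose ?D = ?D"
      by (simp add: transpose_def vec_eq_iff forall_2)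
    finally show ?thesis .
  qed
  show "tmb_lambda y (adapted_basis y) p = l p" if "p \<in> V" for p
    by (simp add: tmb_lambda_def Lambda[OF that] det_2)
  show "tangent_moving_basis V y (adapted_basis y)"
    unfolding tangent_moving_basis_def
  proof (intro conjI ballI)
    fix p assume "p \<in> V"
    let ?c = "\<lambda>j. column j (adapted_basis y p)"
    have c1: "?c 1 $ 1 = 1" and c2: "?c 2 $ 1 = 0" "?c 2 $ 2 = 1"
      using w[OF \<open>p \<in> V\<close>] by (simp_all add: adapted_basis_column)
    show "?c 1 \<noteq> ?c 2" using c1 c2 by auto
    have "?c 1 \<noteq> k *\<^sub>R ?c 2" for k
      using arg_cong[of "?c 1" "k *\<^sub>R ?c 2" "\<lambda>c. c $ 1"] c1 c2 by auto
    then have "?c 1 \<notin> span {?c 2}"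
      by (auto simp: span_singleton)
    moreover have "?c 2 \<noteq> 0" using c2 by auto
    ultimately show "independent {?c 1, ?c 2}"
      by (simp add: independent_insert)
    show "\<forall>j. column j (jacobian y (at p)) \<in> span {?c 1, ?c 2}"
      using z[OF \<open>p \<in> V\<close>]
      by (auto simp: forall_2 column_jacobian adapted_basis_column intro: span_base span_scale)
  qed (use V in \<open>auto intro: smooth_on_adapted_basis\<close>)
qed

section \<open>Coordinates adapted to a wavefront\<close>

lemma diffeo_germI:
  assumes "open A" "open B" "p \<in> A" "smooth_on A h" "smooth_on B g"
    and "\<And>a. a \<in> A \<Longrightarrow> h a \<in> B \<and> g (h a) = a" "\<And>b. b \<in> B \<Longrightarrow> g b \<in> A \<and> h (g b) = b"
    and "h p = q"
  shows "diffeo_germ h p q"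
proof -
  have "homeomorphism A B h g"
    using assms by (intro homeomorphismI smooth_on_imp_continuous_on) auto
  then show ?thesis using assms unfolding diffeo_germ_def by blast
qed

text \<open>The map \<open>(X\<^sub>1, - N\<^sub>2 / N\<^sub>3)\<close> is a local diffeomorphism and \<open>h\<close> is its inverse. A vector \<open>v\<close> in the kernel
  of its derivative satisfies \<open>DX(0)v = 0\<close>, as the other two components of \<open>DX(0)\<close> vanish
  identically, and \<open>(DN(0)v)\<^sub>2 = 0\<close>. Unit length of \<open>N\<close> gives \<open>(DN(0)v)\<^sub>3 = 0\<close>, symmetry of the second
  fundamental form gives \<open>(DN(0)v)\<^sub>1 = 0\<close>, and the immersion condition leaves \<open>v = 0\<close>.\<close>

lemma adapted_coordinates:
  fixes X N :: "real^2 \<Rightarrow> real^3"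
  assumes "open U" "0 \<in> U" "X 0 = 0" and smooth: "smooth_on U X" "smooth_on U N"
    and unit: "\<And>q. q \<in> U \<Longrightarrow> norm (N q) = 1"
    and normal: "\<And>q v. q \<in> U \<Longrightarrow> N q \<bullet> frechet_derivative X (at q) v = 0"
    and N0: "N 0 = axis 3 1"
    and line: "\<And>v. frechet_derivative X (at 0) v $ 2 = 0"
    and rank: "frechet_derivative X (at 0) u $ 1 \<noteq> 0"
    and immersion: "\<And>v. frechet_derivative X (at 0) v = 0 \<Longrightarrow> frechet_derivative N (at 0) v = 0 \<Longrightarrow> v = 0"
  obtains B :: "(real^2) set" and h :: "real^2 \<Rightarrow> real^2"
  where "open B" "0 \<in> B" "diffeo_germ h 0 0" "smooth_on B h" "h ` B \<subseteq> U"
    "\<And>p. p \<in> B \<Longrightarrow> X (h p) $ 1 = p $ 1"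
    "\<And>p. p \<in> B \<Longrightarrow> N (h p) $ 3 \<noteq> 0 \<and> - N (h p) $ 2 / N (h p) $ 3 = p $ 2"
proof -
  let ?X' = "frechet_derivative X (at 0)" and ?N' = "frechet_derivative N (at 0)"
  have X': "(X has_derivative frechet_derivative X (at q)) (at q)"
    and N': "(N has_derivative frechet_derivative N (at q)) (at q)" if "q \<in> U" for q
    using smooth that by (auto intro: smooth_on_has_derivative)
  have N0_inner: "N 0 \<bullet> a = a $ 3" for a
    by (simp add: N0 inner_axis')
  have X'3: "?X' v $ 3 = 0" for v
    using normal[OF \<open>0 \<in> U\<close>, of v] by (simp add: N0_inner)
  have N'3: "?N' v $ 3 = 0" for v
  proof -
    have "((\<lambda>q. N q \<bullet> N q) has_derivative (\<lambda>v. N 0 \<bullet> ?N' v + ?N' v \<bullet> N 0)) (at 0)"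
      by (intro has_derivative_inner N' \<open>0 \<in> U\<close>)
    moreover have "((\<lambda>q. N q \<bullet> N q) has_derivative (\<lambda>v. 0)) (at 0)"
      using unit by (intro has_derivative_transform_within_open[OF has_derivative_const[of 1] \<open>open U\<close> \<open>0 \<in> U\<close>])
        (simp add: dot_square_norm)
    ultimately have "N 0 \<bullet> ?N' v + ?N' v \<bullet> N 0 = 0"
      by (rule has_derivative_unique[THEN fun_cong])
    then show ?thesis by (simp add: inner_commute[of "?N' v" "N 0"] N0_inner)
  qed
  \<comment> \<open>Differentiating \<open>N \<bullet> DX a = 0\<close> in direction \<open>v\<close> expresses \<open>DN v \<bullet> DX a\<close> by a second derivative of \<open>X\<close>.\<close>
  have second: "?N' v \<bullet> ?X' a = - (N 0 \<bullet> frechet_derivative (\<lambda>q. frechet_derivative X (at q) a) (at 0) v)"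
    for a v
  proof -
    have "((\<lambda>q. N q \<bullet> frechet_derivative X (at q) a) has_derivative
        (\<lambda>v. N 0 \<bullet> frechet_derivative (\<lambda>q. frechet_derivative X (at q) a) (at 0) v + ?N' v \<bullet> ?X' a)) (at 0)"
      by (intro has_derivative_inner N' \<open>0 \<in> U\<close>
          smooth_on_has_derivative[OF smooth_on_directional_derivative[OF smooth(1)]])
    moreover have "((\<lambda>q. N q \<bullet> frechet_derivative X (at q) a) has_derivative (\<lambda>v. 0)) (at 0)"
      using normal by (intro has_derivative_transform_within_open[OF has_derivative_const[of 0] \<open>open U\<close> \<open>0 \<in> U\<close>])
        simp
    ultimately have "N 0 \<bullet> frechet_derivative (\<lambda>q. frechet_derivative X (at q) a) (at 0) v + ?N' v \<bullet> ?X' a = 0"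
      by (rule has_derivative_unique[THEN fun_cong])
    then show ?thesis by simp
  qed
  \<comment> \<open>By symmetry \<open>DN v \<bullet> DX u = DN u \<bullet> DX v = 0\<close>, and \<open>DX u\<close> is a nonzero multiple of the first axis.\<close>
  have N'1: "?N' v $ 1 = 0" if "?X' v = 0" for v
  proof -
    have "?N' v \<bullet> ?X' u = ?N' u \<bullet> ?X' v"
      unfolding second
      using directional_derivatives_commute[OF \<open>open U\<close> smooth(1) \<open>0 \<in> U\<close>, of u v] by simp
    then have "?N' v $ 1 * ?X' u $ 1 = 0"
      using that line[of u] X'3[of u] by (simp add: inner_vec_def sum_3)
    then show ?thesis using rank by simp
  qed
  define \<phi> :: "real^2 \<Rightarrow> real^2" where "\<phi> q = vector [X q $ 1, - N q $ 2 / N q $ 3]" for q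
  define W where "W = {q \<in> U. N q $ 3 \<noteq> 0}"
  have "open W"
  proof -
    have "continuous_on U (\<lambda>q. N q $ 3)"
      by (intro smooth_on_imp_continuous_on smooth_on_nth smooth \<open>open U\<close>)
    then have "open (U \<inter> (\<lambda>q. N q $ 3) -` (- {0}))"
      using \<open>open U\<close> by (simp add: continuous_on_open_vimage open_Compl Int_commute)
    moreover have "W = U \<inter> (\<lambda>q. N q $ 3) -` (- {0})" by (auto simp: W_def)
    ultimately show ?thesis by simp
  qed
  have "W \<subseteq> U" by (auto simp: W_def)
  note smoothW = smooth[THEN smooth_on_subset, OF \<open>W \<subseteq> U\<close>]
  have "0 \<in> W" using \<open>0 \<in> U\<close> N0 by (simp add: W_def)
  have \<phi>: "smooth_on W \<phi>"
  proof (rule smooth_on_vec[OF \<open>open W\<close>])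
    have "smooth_on W (\<lambda>q. - N q $ 2 / N q $ 3)"
      by (intro smooth_on_divide smooth_on_minus smooth_on_nth smoothW \<open>open W\<close>) (simp add: W_def)
    moreover have "smooth_on W (\<lambda>q. X q $ 1)"
      by (intro smooth_on_nth smoothW \<open>open W\<close>)
    ultimately show "smooth_on W (\<lambda>q. \<phi> q $ i)" for i
      using exhaust_2[of i] by (auto simp: \<phi>_def)
  qed
  have \<phi>': "frechet_derivative \<phi> (at 0) v $ 1 = ?X' v $ 1"
    "frechet_derivative \<phi> (at 0) v $ 2 = - ?N' v $ 2" for v
  proof -
    note nth = frechet_derivative_nth[OF smooth_on_differentiable[OF \<phi> \<open>0 \<in> W\<close>], symmetric]
    show "frechet_derivative \<phi> (at 0) v $ 1 = ?X' v $ 1"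
      using frechet_derivative_nth[OF smooth_on_differentiable[OF smooth(1) \<open>0 \<in> U\<close>]]
      by (simp add: nth \<phi>_def)
    have "((\<lambda>q. N q $ i) has_derivative (\<lambda>v. ?N' v $ i)) (at 0)" for i
      by (intro bounded_linear.has_derivative[OF bounded_linear_vec_nth] N' \<open>0 \<in> U\<close>)
    from has_derivative_divide'[OF has_derivative_minus[OF this[of 2]] this[of 3]]
    have "((\<lambda>q. - N q $ 2 / N q $ 3) has_derivative (\<lambda>v. - ?N' v $ 2)) (at 0)"
      by (simp add: N0 axis_def)
    then show "frechet_derivative \<phi> (at 0) v $ 2 = - ?N' v $ 2"
      by (simp add: nth \<phi>_def frechet_derivative_at[symmetric])
  qed
  have inj: "inj (frechet_derivative \<phi> (at 0))"
  proof -
    have lin: "linear (frechet_derivative \<phi> (at 0))"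
      using smooth_on_has_derivative[OF \<phi> \<open>0 \<in> W\<close>] by (rule has_derivative_linear)
    have "v = 0" if "frechet_derivative \<phi> (at 0) v = 0" for v
    proof -
      have *: "?X' v $ 1 = 0" "?N' v $ 2 = 0"
        using \<phi>'[of v] that by simp_all
      then have "?X' v = 0"
        using line[of v] X'3[of v] by (simp add: vec_eq_iff forall_3)
      moreover have "?N' v = 0"
        using N'1[OF \<open>?X' v = 0\<close>] * N'3[of v] by (simp add: vec_eq_iff forall_3)
      ultimately show ?thesis by (rule immersion)
    qed
    then show ?thesis using lin by (simp add: linear_injective_0)
  qed
  obtain A B g where AB: "open A" "A \<subseteq> W" "0 \<in> A" "open B" "homeomorphism A B \<phi> g" "smooth_on B g"
    using smooth_inverse_function_theorem[OF \<open>open W\<close> \<phi> \<open>0 \<in> W\<close> inj] by metis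
  have "\<phi> 0 = 0"
    using \<open>X 0 = 0\<close> N0 by (simp add: \<phi>_def vec_eq_iff forall_2 axis_def)
  have \<phi>g: "\<phi> a \<in> B \<and> g (\<phi> a) = a" if "a \<in> A" for a
    using AB(5) that by (auto simp: homeomorphism_def)
  have g\<phi>: "g b \<in> A \<and> \<phi> (g b) = b" if "b \<in> B" for b
    using AB(5) that by (auto simp: homeomorphism_def)
  have 0: "0 \<in> B" "g 0 = 0" using \<phi>g[OF \<open>0 \<in> A\<close>] \<open>\<phi> 0 = 0\<close> by auto
  have "diffeo_germ g 0 0"
    using 0 AB \<phi>g g\<phi> smooth_on_subset[OF \<phi>] by (intro diffeo_germI[of B A _ _ \<phi>]) auto
  moreover have "N (g p) $ 3 \<noteq> 0 \<and> - N (g p) $ 2 / N (g p) $ 3 = p $ 2" "X (g p) $ 1 = p $ 1"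
    if "p \<in> B" for p
  proof -
    have "\<phi> (g p) $ i = p $ i" for i using g\<phi>[OF that] by simp
    from this[of 1] this[of 2]
    show "N (g p) $ 3 \<noteq> 0 \<and> - N (g p) $ 2 / N (g p) $ 3 = p $ 2" "X (g p) $ 1 = p $ 1"
      using g\<phi>[OF that] AB(2) by (auto simp: W_def \<phi>_def)
  qed
  moreover have "g ` B \<subseteq> U" using g\<phi> AB(2) \<open>W \<subseteq> U\<close> by auto
  ultimately show ?thesis
    using that[of B g] AB 0 by blast
qed

lemma orthonormal_frame:
  fixes e n :: "real^3"
  assumes "norm e = 1" "norm n = 1" "n \<bullet> e = 0"
  defines A_def: "A \<equiv> vector [e, cross3 n e, n] :: real^3^3"
  shows "orthogonal_transformation ((*v) A)"
    and "A *v n = axis 3 1" "(A *v e) $ 1 = 1" "(A *v e) $ 2 = 0" "(A *v e) $ 3 = 0"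
proof -
  have A: "A $ 1 = e" "A $ 2 = cross3 n e" "A $ 3 = n"
    by (simp_all add: A_def)
  have "(norm (cross3 n e))\<^sup>2 = 1"
    using norm_cross_dot[of n e] assms by simp
  then have "norm (cross3 n e) = 1"
    using power2_eq_1_iff[of "norm (cross3 n e)"] norm_ge_zero[of "cross3 n e"] by linarith
  then have "orthogonal_matrix A"
    using assms(1-3) by (simp add: orthogonal_matrix_orthonormal_rows forall_3 row_def A orthogonal_def
        dot_cross_self inner_commute[of e n])
  then show "orthogonal_transformation ((*v) A)"
    by (simp add: orthogonal_transformation_matrix)
  have comp: "(A *v v) $ i = A $ i \<bullet> v" for v i
    by (simp add: matrix_vector_mul_component)
  show "A *v n = axis 3 1"
    using assms(1-3) by (simp add: vec_eq_iff forall_3 comp A axis_def dot_cross_self inner_commute[of e n]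
        norm_eq_1)
  show "(A *v e) $ 1 = 1" "(A *v e) $ 2 = 0" "(A *v e) $ 3 = 0"
    using assms(1-3) by (simp_all add: comp A dot_cross_self norm_eq_1)
qed

text \<open>The witness \<open>u\<close> records that \<open>e\<close> itself is attained, so that orthogonality to the range is
  inherited by \<open>e\<close>.\<close>

lemma rank_1_range:
  fixes A :: "real^'n^'m"
  assumes "rank A = 1"
  obtains e u where "norm e = 1" "A *v u = e" "\<And>v. \<exists>k. A *v v = k *\<^sub>R e"
proof -
  have "A \<noteq> 0" using assms by auto
  then obtain u where u: "A *v u \<noteq> 0"
    by (metis matrix_eq matrix_vector_mult_0)
  define e where "e = A *v (inverse (norm (A *v u)) *\<^sub>R u)"
  have e: "e = inverse (norm (A *v u)) *\<^sub>R (A *v u)"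
    by (simp add: e_def matrix_vector_mult_scaleR)
  have "norm e = 1" using u by (simp add: e)
  have "e \<noteq> 0" using \<open>norm e = 1\<close> by auto
  have "range ((*v) A) \<subseteq> span {e}"
  proof (rule card_ge_dim_independent)
    show "{e} \<subseteq> range ((*v) A)" by (simp add: e_def)
    show "independent {e}" using \<open>e \<noteq> 0\<close> by simp
    show "dim (range ((*v) A)) \<le> card {e}" using assms by (simp add: rank_dim_range)
  qed
  then have "\<exists>k. A *v v = k *\<^sub>R e" for v
    by (auto simp: span_singleton)
  then show ?thesis using that \<open>norm e = 1\<close> e_def by blast
qed

text \<open>Along the second parameter the first component of \<open>T \<circ> x \<circ> h\<close> is constant, so its derivative has
  the form \<open>(0, l, m)\<close>. Orthogonality to the normal reads \<open>N\<^sub>2 l + N\<^sub>3 m = 0\<close>, that is \<open>m = z l\<close> for the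
  slope \<open>z = - N\<^sub>2 / N\<^sub>3\<close>, which \<open>h\<close> has made the second parameter.\<close>

lemma isometry_to_adapted_position:
  fixes x :: "real^2 \<Rightarrow> real^3"
  assumes "0 \<in> U" "x 0 = 0" "wavefront U x" "rank (jacobian x (at 0)) = 1"
  obtains T :: "real^3 \<Rightarrow> real^3" and B :: "(real^2) set" and h :: "real^2 \<Rightarrow> real^2" and l :: "real^2 \<Rightarrow> real"
  where "orthogonal_transformation T" "open B" "0 \<in> B" "diffeo_germ h 0 0"
    "smooth_on B (\<lambda>p. T (x (h p)))" "smooth_on B l" "l 0 = 0"
    "\<And>p. p \<in> B \<Longrightarrow> T (x (h p)) $ 1 = p $ 1"
    "\<And>p. p \<in> B \<Longrightarrow> frechet_derivative (\<lambda>p. T (x (h p))) (at p) (axis 2 1) = l p *\<^sub>R vector [0, 1, p $ 2]"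
proof -
  obtain V n where "open V" "0 \<in> V" "V \<subseteq> U" and n: "unit_normal_field V x n"
    and imm: "immersive_at (\<lambda>r. (x r, n r)) 0"
    using assms(1,3) unfolding wavefront_def by blast
  have "smooth_on U x" using assms(3) by (simp add: wavefront_def frontal_def)
  then have x: "smooth_on V x" using \<open>V \<subseteq> U\<close> by (rule smooth_on_subset)
  have "smooth_on V n" and unit: "\<And>q. q \<in> V \<Longrightarrow> norm (n q) = 1"
    using n by (auto simp: unit_normal_field_def)
  have x'_jac: "frechet_derivative x (at q) = (*v) (jacobian x (at q))" if "q \<in> V" for q
    using smooth_on_differentiable[OF x that] by (metis frechet_derivative_at jacobian_works)
  have normal: "n q \<bullet> frechet_derivative x (at q) v = 0" if "q \<in> V" for q v
    using n that by (simp add: x'_jac[OF that] matrix_mult_sum unit_normal_field_def inner_sum_right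
        scalar_mult_eq_scaleR)
  obtain e u where e: "norm e = 1" "jacobian x (at 0) *v u = e"
    and range: "\<And>v. \<exists>k. jacobian x (at 0) *v v = k *\<^sub>R e"
    using rank_1_range[OF assms(4)] by metis
  have "n 0 \<bullet> e = 0"
    using normal[OF \<open>0 \<in> V\<close>, of u] e(2) by (simp add: x'_jac[OF \<open>0 \<in> V\<close>])
  define T where "T = (*v) (vector [e, cross3 (n 0) e, n 0] :: real^3^3)"
  note frame = orthonormal_frame[OF e(1) unit[OF \<open>0 \<in> V\<close>] \<open>n 0 \<bullet> e = 0\<close>, folded T_def]
  have T: "linear T" using frame(1) by (rule orthogonal_transformation_linear)
  then have blT: "bounded_linear T" by (simp add: linear_conv_bounded_linear)
  have T': "frechet_derivative (\<lambda>q. T (f q)) (at q) v = T (frechet_derivative f (at q) v)"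
    if "smooth_on V f" "q \<in> V" for f :: "real^2 \<Rightarrow> real^3" and q v
    using bounded_linear.has_derivative[OF blT smooth_on_has_derivative[OF that]]
    by (metis frechet_derivative_at)
  define X where "X = (\<lambda>q. T (x q))"
  define N where "N = (\<lambda>q. T (n q))"
  have X': "frechet_derivative X (at q) v = T (frechet_derivative x (at q) v)" if "q \<in> V" for q v
    using T'[OF x that] by (simp add: X_def)
  have N': "frechet_derivative N (at q) v = T (frechet_derivative n (at q) v)" if "q \<in> V" for q v
    using T'[OF \<open>smooth_on V n\<close> that] by (simp add: N_def)
  have smooth: "smooth_on V X" "smooth_on V N"
    unfolding X_def N_def
    by (intro smooth_on_bounded_linear[OF blT] x \<open>smooth_on V n\<close> \<open>open V\<close>)+
  have NX': "N q \<bullet> frechet_derivative X (at q) v = 0" if "q \<in> V" for q v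
    using frame(1) normal[OF that] by (simp add: N_def X'[OF that] orthogonal_transformation_def)
  have line: "frechet_derivative X (at 0) v $ 2 = 0" for v
    using range[of v] frame(4) linear_cmul[OF T]
    by (auto simp: X'[OF \<open>0 \<in> V\<close>] x'_jac[OF \<open>0 \<in> V\<close>])
  have TZ: "a = 0" if "T a = 0" for a
    using that orthogonal_transformation_norm[OF frame(1), of a] by simp
  have immersion: "v = 0"
    if "frechet_derivative X (at 0) v = 0" "frechet_derivative N (at 0) v = 0" for v
  proof -
    have "((\<lambda>r. (x r, n r)) has_derivative
        (\<lambda>v. (frechet_derivative x (at 0) v, frechet_derivative n (at 0) v))) (at 0)"
      using x \<open>smooth_on V n\<close> \<open>0 \<in> V\<close>
      by (intro has_derivative_Pair smooth_on_has_derivative)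
    then have pair: "frechet_derivative (\<lambda>r. (x r, n r)) (at 0)
        = (\<lambda>v. (frechet_derivative x (at 0) v, frechet_derivative n (at 0) v))"
        and lin: "linear (frechet_derivative (\<lambda>r. (x r, n r)) (at 0))"
      by (auto simp flip: frechet_derivative_at intro: has_derivative_linear)
    have "frechet_derivative (\<lambda>r. (x r, n r)) (at 0) v = 0"
      using that TZ by (simp add: zero_prod_def pair X'[OF \<open>0 \<in> V\<close>] N'[OF \<open>0 \<in> V\<close>])
    then show "v = 0"
      using imm lin by (simp add: immersive_at_def linear_injective_0)
  qed
  have X0: "X 0 = 0" using \<open>x 0 = 0\<close> linear_0[OF T] by (simp add: X_def)
  have unitN: "norm (N q) = 1" if "q \<in> V" for q
    using unit[OF that] orthogonal_transformation_norm[OF frame(1)] by (simp add: N_def)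
  have N0: "N 0 = axis 3 1" using frame(2) by (simp add: N_def)
  have rank: "frechet_derivative X (at 0) u $ 1 \<noteq> 0"
    using frame(3) e(2) by (simp add: X'[OF \<open>0 \<in> V\<close>] x'_jac[OF \<open>0 \<in> V\<close>])
  obtain B :: "(real^2) set" and h where B: "open B" "0 \<in> B" and h: "diffeo_germ h 0 0" "smooth_on B h" "h ` B \<subseteq> V"
    and first: "\<And>p. p \<in> B \<Longrightarrow> X (h p) $ 1 = p $ 1"
    and slope: "\<And>p. p \<in> B \<Longrightarrow> N (h p) $ 3 \<noteq> 0 \<and> - N (h p) $ 2 / N (h p) $ 3 = p $ 2"
    using adapted_coordinates[OF \<open>open V\<close> \<open>0 \<in> V\<close> X0 smooth unitN NX' N0 line rank immersion]
    by blast
  define Y where "Y = (\<lambda>p. X (h p))"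
  define l where "l = (\<lambda>p. frechet_derivative Y (at p) (axis 2 1) $ 2)"
  have Y: "smooth_on B Y"
    unfolding Y_def by (rule smooth_on_compose[OF B(1) \<open>open V\<close> h(3,2) smooth(1)])
  have Y': "frechet_derivative Y (at p) v = frechet_derivative X (at (h p)) (frechet_derivative h (at p) v)"
    if "p \<in> B" for p v
  proof -
    have "h p \<in> V" using h(3) that by auto
    from has_derivative_compose[OF smooth_on_has_derivative[OF h(2) that]
        smooth_on_has_derivative[OF smooth(1) this]]
    show ?thesis unfolding Y_def by (metis frechet_derivative_at)
  qed
  have "smooth_on B l"
    unfolding l_def by (intro smooth_on_nth smooth_on_directional_derivative Y B)
  moreover have "l 0 = 0"
  proof -
    have "h 0 = 0" using h(1) by (simp add: diffeo_germ_def)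
    then show ?thesis using line by (simp add: l_def Y'[OF B(2)])
  qed
  moreover have "frechet_derivative Y (at p) (axis 2 1) = l p *\<^sub>R vector [0, 1, p $ 2]" if "p \<in> B" for p
  proof -
    let ?d = "frechet_derivative Y (at p) (axis 2 1)"
    have "((\<lambda>p. Y p $ 1) has_derivative (\<lambda>v. v $ 1)) (at p)"
      by (rule has_derivative_transform_within_open[OF
            bounded_linear.has_derivative[OF bounded_linear_vec_nth has_derivative_ident] B(1) that])
        (simp add: Y_def first)
    then have "frechet_derivative (\<lambda>p. Y p $ 1) (at p) (axis 2 1) = (axis 2 1 :: real^2) $ 1"
      by (metis frechet_derivative_at)
    then have 1: "?d $ 1 = 0"
      using frechet_derivative_nth[OF smooth_on_differentiable[OF Y that]] by (simp add: axis_def)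
    have "N (h p) \<bullet> ?d = 0"
      using NX' h(3) that by (auto simp: Y'[OF that])
    then have "N (h p) $ 2 * l p + N (h p) $ 3 * ?d $ 3 = 0"
      using 1 by (simp add: inner_vec_def sum_3 l_def)
    moreover have "N (h p) $ 2 = - (p $ 2 * N (h p) $ 3)" and "N (h p) $ 3 \<noteq> 0"
      using slope[OF that] by (auto simp: field_simps)
    ultimately have "N (h p) $ 3 * (?d $ 3 - l p * p $ 2) = 0"
      by (simp add: algebra_simps)
    then have 3: "?d $ 3 = l p * p $ 2"
      using \<open>N (h p) $ 3 \<noteq> 0\<close> by simp
    show ?thesis
      using 1 3 by (simp add: vec_eq_iff forall_3 l_def)
  qed
  ultimately show ?thesis
    using that[OF frame(1) B h(1), of l] Y first by (simp add: Y_def X_def)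
qed

section \<open>The normal form\<close>

text \<open>The fundamental theorem of calculus on the segment from \<open>(w, 0)\<close> to \<open>(w, z)\<close>, in the second and
  third components; the square \<open>V\<close> contains the segment. Equality with \<open>Y\<close> also makes the normal form
  smooth, without any differentiation under the integral sign.\<close>

lemma normal_form_of_vertical_derivative:
  fixes Y :: "real^2 \<Rightarrow> real^3"
  assumes V: "V = {p. \<bar>p $ 1\<bar> < \<epsilon> \<and> \<bar>p $ 2\<bar> < \<epsilon>}"
    and Y: "smooth_on V Y" and l: "smooth_on V l"
    and first: "\<And>p. p \<in> V \<Longrightarrow> Y p $ 1 = p $ 1"
    and vertical: "\<And>p. p \<in> V \<Longrightarrow> frechet_derivative Y (at p) (axis 2 1) = l p *\<^sub>R vector [0, 1, p $ 2]"
    and "p \<in> V"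
  shows "normal_form l (\<lambda>w. Y (vector [w, 0]) $ 2) (\<lambda>w. Y (vector [w, 0]) $ 3) p = Y p"
proof -
  define \<gamma> :: "real \<Rightarrow> real^2" where "\<gamma> t = vector [p $ 1, t]" for t
  let ?I = "{min 0 (p $ 2)..max 0 (p $ 2)}"
  have \<gamma>V: "\<gamma> t \<in> V" if "min 0 (p $ 2) \<le> t" "t \<le> max 0 (p $ 2)" for t
    using that \<open>p \<in> V\<close> by (auto simp: V \<gamma>_def)
  have \<gamma>: "(\<gamma> has_derivative (\<lambda>t. t *\<^sub>R axis 2 1)) (at t)" for t
  proof -
    have "\<gamma> = (\<lambda>t. p $ 1 *\<^sub>R axis 1 1 + t *\<^sub>R axis 2 1)"
      by (simp add: \<gamma>_def fun_eq_iff vec_eq_iff forall_2 axis_def)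
    then show ?thesis by (auto intro!: derivative_eq_intros)
  qed
  have \<gamma>_cont: "continuous_on ?I \<gamma>"
    using \<gamma> by (intro continuous_at_imp_continuous_on ballI has_derivative_continuous)
  have D: "((\<lambda>t. Y (\<gamma> t) $ i) has_vector_derivative
      l (\<gamma> t) * (vector [0, 1, t] :: real^3) $ i) (at t within ?I)"
    if "min 0 (p $ 2) \<le> t" "t \<le> max 0 (p $ 2)" for i t
  proof -
    note Y' = smooth_on_has_derivative[OF Y \<gamma>V[OF that]]
    have lin: "linear (frechet_derivative Y (at (\<gamma> t)))"
      using Y' by (rule has_derivative_linear)
    have "((\<lambda>t. Y (\<gamma> t) $ i) has_derivative
        (\<lambda>s. frechet_derivative Y (at (\<gamma> t)) (s *\<^sub>R axis 2 1) $ i)) (at t)"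
      using has_derivative_compose[OF \<gamma> Y']
      by (rule bounded_linear.has_derivative[OF bounded_linear_vec_nth])
    moreover have "\<gamma> t $ 2 = t" by (simp add: \<gamma>_def)
    ultimately have "((\<lambda>t. Y (\<gamma> t) $ i) has_vector_derivative
        l (\<gamma> t) * (vector [0, 1, t] :: real^3) $ i) (at t)"
      using vertical[OF \<gamma>V[OF that]]
      by (simp add: has_vector_derivative_def linear_cmul[OF lin] mult.assoc)
    then show ?thesis by (rule has_vector_derivative_at_within)
  qed
  have lcont: "continuous_on ?I (\<lambda>t. l (\<gamma> t))"
    by (rule continuous_on_compose2[OF smooth_on_imp_continuous_on[OF l] \<gamma>_cont])
      (use \<gamma>V in auto)
  have "\<gamma> (p $ 2) = p" by (simp add: \<gamma>_def vec_eq_iff forall_2)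
  have "(LBINT t=ereal 0..ereal (p $ 2). l (\<gamma> t)) = Y (\<gamma> (p $ 2)) $ 2 - Y (\<gamma> 0) $ 2"
    using lcont D[where i = 2] by (intro interval_integral_FTC_finite) simp_all
  moreover have "(LBINT t=ereal 0..ereal (p $ 2). t * l (\<gamma> t)) = Y (\<gamma> (p $ 2)) $ 3 - Y (\<gamma> 0) $ 3"
    using lcont D[where i = 3]
    by (intro interval_integral_FTC_finite continuous_on_mult continuous_on_id)
      (simp_all add: mult.commute)
  ultimately show ?thesis
    using first[OF \<open>p \<in> V\<close>] unfolding \<open>\<gamma> (p $ 2) = p\<close>
    by (simp add: normal_form_def vec_eq_iff forall_3 \<gamma>_def zero_ereal_def)
qed

lemma open_coordinate_square: "open {p :: real^2. \<bar>p $ 1\<bar> < \<epsilon> \<and> \<bar>p $ 2\<bar> < \<epsilon>}"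
  by (intro open_Collect_conj open_Collect_less continuous_intros)

lemma coordinate_square_in_neighbourhood:
  fixes B :: "(real^2) set"
  assumes "open B" "0 \<in> B"
  obtains \<epsilon> where "0 < \<epsilon>" "{p. \<bar>p $ 1\<bar> < \<epsilon> \<and> \<bar>p $ 2\<bar> < \<epsilon>} \<subseteq> B"
proof -
  obtain r where r: "0 < r" "ball 0 r \<subseteq> B"
    using assms open_contains_ball by blast
  have "p \<in> ball 0 r" if "\<bar>p $ 1\<bar> < r / 2" "\<bar>p $ 2\<bar> < r / 2" for p :: "real^2"
    using norm_le_l1_cart[of p] that by (simp add: sum_2)
  then show ?thesis using r by (intro that[of "r / 2"]) auto
qed

text \<open>The shear \<open>b \<mapsto> b - (0, f1(b\<^sub>1), f2(b\<^sub>1))\<close> preserves \<open>b\<^sub>1\<close>, so it maps the slab \<open>|b\<^sub>1| < \<epsilon>\<close> to itself with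
  inverse \<open>b \<mapsto> b + (0, f1(b\<^sub>1), f2(b\<^sub>1))\<close>.\<close>

lemma shear_isometry_diffeo_germ:
  fixes T :: "real^3 \<Rightarrow> real^3" and f1 f2 :: "real \<Rightarrow> real"
  assumes T: "orthogonal_transformation T" and "0 < \<epsilon>"
    and f: "smooth_on {-\<epsilon><..<\<epsilon>} f1" "smooth_on {-\<epsilon><..<\<epsilon>} f2" "f1 0 = 0" "f2 0 = 0"
  shows "diffeo_germ (\<lambda>a. T a - vector [0, f1 (T a $ 1), f2 (T a $ 1)]) 0 0"
proof -
  obtain S where S: "linear S" "\<And>a. S (T a) = a" "\<And>b. T (S b) = b"
  proof
    show "linear (inv T)" "T (inv T b) = b" "inv T (T a) = a" for a b
      using T orthogonal_transformation_inv[OF T] orthogonal_transformation_bij[OF T]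
      by (auto simp: orthogonal_transformation_linear bij_def surj_f_inv_f)
  qed
  have "linear T" using T by (rule orthogonal_transformation_linear)
  define s where "s c = (vector [0, f1 c, f2 c] :: real^3)" for c
  define B where "B = {b :: real^3. \<bar>b $ 1\<bar> < \<epsilon>}"
  have "open B" unfolding B_def by (intro open_Collect_less continuous_intros)
  have "open (T -` B)"
    using \<open>open B\<close> \<open>linear T\<close> by (intro open_vimage linear_continuous_on) (auto simp: linear_conv_bounded_linear)
  have s: "smooth_on {-\<epsilon><..<\<epsilon>} s"
  proof (rule smooth_on_vec)
    show "smooth_on {-\<epsilon><..<\<epsilon>} (\<lambda>c. s c $ i)" for i
      using exhaust_3[of i] f smooth_on_const[of "{-\<epsilon><..<\<epsilon>}" "0::real"] by (auto simp: s_def)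
  qed simp
  have shear: "smooth_on B (\<lambda>b. s (b $ 1))"
    by (rule smooth_on_compose[OF \<open>open B\<close> _ _ _ s])
      (auto simp: B_def intro: smooth_on_nth[OF \<open>open B\<close> smooth_on_ident[OF \<open>open B\<close>], unfolded B_def])
  have s1: "s c $ 1 = 0" for c by (simp add: s_def)
  have "diffeo_germ (\<lambda>a. T a - s (T a $ 1)) 0 0"
  proof (rule diffeo_germI[where A = "T -` B" and B = B and g = "\<lambda>b. S (b + s (b $ 1))"])
    show "0 \<in> T -` B" "T 0 - s (T 0 $ 1) = 0"
      using linear_0[OF \<open>linear T\<close>] \<open>0 < \<epsilon>\<close> f by (auto simp: B_def s_def vec_eq_iff forall_3)
    have "smooth_on (T -` B) T" using \<open>linear T\<close> \<open>open (T -` B)\<close> by (rule smooth_on_linear)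
    then show "smooth_on (T -` B) (\<lambda>a. T a - s (T a $ 1))"
      using smooth_on_compose[OF \<open>open (T -` B)\<close> \<open>open B\<close> _ _ shear, of T]
      by (intro smooth_on_diff \<open>open (T -` B)\<close>) auto
    show "smooth_on B (\<lambda>b. S (b + s (b $ 1)))"
      using \<open>linear S\<close> by (intro smooth_on_bounded_linear[of S] smooth_on_add smooth_on_ident shear \<open>open B\<close>)
        (auto simp: linear_conv_bounded_linear)
  qed (use \<open>open B\<close> \<open>open (T -` B)\<close> S s1 in \<open>auto simp: B_def\<close>)
  then show ?thesis by (simp add: s_def)
qed

theorem theorem4p1:
  fixes U :: "(real^2) set"
    and x :: "real^2 \<Rightarrow> real^3"
    and \<Omega> :: "real^2 \<Rightarrow> real^2^3"
  assumes "open U" and "0 \<in> U" and "x 0 = 0"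
    and "wavefront U x"
    and "tangent_moving_basis U x \<Omega>"
    and "0 \<in> singular_set U x"
    and "rank (jacobian x (at 0)) = 1"
  shows "\<exists>(T :: real^3 \<Rightarrow> real^3) (l :: real^2 \<Rightarrow> real) (f1 :: real \<Rightarrow> real) (f2 :: real \<Rightarrow> real)
          (\<epsilon> :: real) (V :: (real^2) set) (y :: real^2 \<Rightarrow> real^3) (\<Omega>' :: real^2 \<Rightarrow> real^2^3).
      (\<forall>a b. dist (T a) (T b) = dist a b) \<and>
      \<epsilon> > 0 \<and> V = {p. \<bar>p $ 1\<bar> < \<epsilon> \<and> \<bar>p $ 2\<bar> < \<epsilon>} \<and>
      smooth_on V l \<and> smooth_on {-\<epsilon><..<\<epsilon>} f1 \<and> smooth_on {-\<epsilon><..<\<epsilon>} f2 \<and>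
      l 0 = 0 \<and>
      y = normal_form l f1 f2 \<and>
      \<Omega>' = adapted_basis y \<and>
      R_equivalent 0 (T 0) (T \<circ> x) y \<and>
      tangent_moving_basis V y \<Omega>' \<and>
      (\<forall>p\<in>V. l p = tmb_lambda y \<Omega>' p \<and>
             tmb_Lambda y \<Omega>' p = vector [vector [1, 0], vector [0, tmb_lambda y \<Omega>' p]]) \<and>
      A_equivalent 0 0 x
        (\<lambda>p. vector [p $ 1,
                     LBINT t=0..p $ 2. l (vector [p $ 1, t]),
                     LBINT t=0..p $ 2. t * l (vector [p $ 1, t])])"
proof -
  obtain T :: "real^3 \<Rightarrow> real^3" and B :: "(real^2) set" and h l where T: "orthogonal_transformation T" and B: "open B" "0 \<in> B"
    and h: "diffeo_germ h 0 0" and YB: "smooth_on B (\<lambda>p. T (x (h p)))"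
    and lB: "smooth_on B l" and "l 0 = 0"
    and firstB: "\<And>p. p \<in> B \<Longrightarrow> T (x (h p)) $ 1 = p $ 1"
    and verticalB: "\<And>p. p \<in> B \<Longrightarrow>
      frechet_derivative (\<lambda>p. T (x (h p))) (at p) (axis 2 1) = l p *\<^sub>R vector [0, 1, p $ 2]"
    by (rule isometry_to_adapted_position[OF assms(2,3,4,7)]) blast
  obtain \<epsilon> where "0 < \<epsilon>" and square: "{p. \<bar>p $ 1\<bar> < \<epsilon> \<and> \<bar>p $ 2\<bar> < \<epsilon>} \<subseteq> B"
    using coordinate_square_in_neighbourhood[OF B] .
  define V where "V = {p :: real^2. \<bar>p $ 1\<bar> < \<epsilon> \<and> \<bar>p $ 2\<bar> < \<epsilon>}"
  have V: "open V" "0 \<in> V" "V \<subseteq> B"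
    using open_coordinate_square \<open>0 < \<epsilon>\<close> square by (auto simp: V_def)
  define Y where "Y = (\<lambda>p. T (x (h p)))"
  have Y: "smooth_on V Y" and l: "smooth_on V l"
    using smooth_on_subset[OF YB V(3)] smooth_on_subset[OF lB V(3)] by (simp_all add: Y_def)
  have first: "Y p $ 1 = p $ 1"
    and vertical: "frechet_derivative Y (at p) (axis 2 1) = l p *\<^sub>R vector [0, 1, p $ 2]"
    if "p \<in> V" for p
    using firstB[of p] verticalB[of p] that V(3) by (auto simp: Y_def)
  define f1 where "f1 = (\<lambda>w. Y (vector [w, 0]) $ 2)"
  define f2 where "f2 = (\<lambda>w. Y (vector [w, 0]) $ 3)"
  define y where "y = normal_form l f1 f2"
  have y_eq: "y p = Y p" if "p \<in> V" for p
    unfolding y_def f1_def f2_def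
    by (rule normal_form_of_vertical_derivative[OF V_def Y l first vertical that])
  have "h 0 = 0" using h by (simp add: diffeo_germ_def)
  have "T 0 = 0" using T by (intro linear_0 orthogonal_transformation_linear)
  then have "Y 0 = 0" using \<open>h 0 = 0\<close> \<open>x 0 = 0\<close> by (simp add: Y_def)
  have axis: "smooth_on {-\<epsilon><..<\<epsilon>} (\<lambda>w. Y (vector [w, 0]))"
  proof (rule smooth_on_compose[OF _ V(1) _ _ Y])
    have "linear (\<lambda>w. vector [w, 0] :: real^2)"
      by (intro linearI) (simp_all add: vec_eq_iff forall_2)
    then show "smooth_on {-\<epsilon><..<\<epsilon>} (\<lambda>w. vector [w, 0] :: real^2)"
      by (rule smooth_on_linear) simp
  qed (auto simp: V_def)
  have f: "smooth_on {-\<epsilon><..<\<epsilon>} f1" "smooth_on {-\<epsilon><..<\<epsilon>} f2"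
    unfolding f1_def f2_def by (intro smooth_on_nth axis; simp)+
  have f0: "f1 0 = 0" "f2 0 = 0"
  proof -
    have "(vector [0, 0] :: real^2) = 0" by (simp add: vec_eq_iff forall_2)
    then show "f1 0 = 0" "f2 0 = 0" using \<open>Y 0 = 0\<close> by (simp_all add: f1_def f2_def)
  qed
  have y: "smooth_on V y"
    using smooth_on_cong[OF V(1) Y] y_eq by metis
  have y': "frechet_derivative y (at p) = frechet_derivative Y (at p)" if "p \<in> V" for p
    using frechet_derivative_transform_within_open[OF smooth_on_differentiable[OF Y that] V(1) that, of y]
      y_eq by simp
  have w: "frechet_derivative y (at p) (axis 1 1) $ 1 = 1" if "p \<in> V" for p
  proof -
    have "((\<lambda>p. y p $ 1) has_derivative (\<lambda>v. v $ 1)) (at p)"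
      by (rule has_derivative_transform_within_open[OF
            bounded_linear.has_derivative[OF bounded_linear_vec_nth has_derivative_ident] V(1) that])
        (simp add: y_eq first)
    then have "frechet_derivative (\<lambda>p. y p $ 1) (at p) (axis 1 1) = (axis 1 1 :: real^2) $ 1"
      by (metis frechet_derivative_at)
    then show ?thesis
      using frechet_derivative_nth[OF smooth_on_differentiable[OF y that]] by (simp add: axis_def)
  qed
  have z: "frechet_derivative y (at p) (axis 2 1) = l p *\<^sub>R vector [0, 1, p $ 2]" if "p \<in> V" for p
    using vertical[OF that] y'[OF that] by simp
  note basis = adapted_basis_is_tangent_moving_basis[OF V(1) y w z]
  have near: "\<forall>\<^sub>F p in nhds 0. p \<in> V"
    using V by (intro eventually_nhds_in_open)
  have R: "R_equivalent 0 (T 0) (T \<circ> x) y"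
    unfolding R_equivalent_def
  proof (intro conjI exI)
    show "\<forall>\<^sub>F r in nhds 0. y r = (T \<circ> x) (h r)"
      using near by (rule eventually_mono) (simp add: y_eq Y_def)
  qed (use h y_eq[OF V(2)] \<open>Y 0 = 0\<close> \<open>T 0 = 0\<close> \<open>x 0 = 0\<close> in auto)
  define y0 :: "real^2 \<Rightarrow> real^3" where "y0 = (\<lambda>p. vector [p $ 1, LBINT t=0..p $ 2. l (vector [p $ 1, t]),
    LBINT t=0..p $ 2. t * l (vector [p $ 1, t])])"
  define k where "k = (\<lambda>a. T a - vector [0, f1 (T a $ 1), f2 (T a $ 1)])"
  have y0_eq: "y0 p = k (x (h p))" if "p \<in> V" for p
  proof -
    have "y0 p = y p - vector [0, f1 (p $ 1), f2 (p $ 1)]"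
      by (simp add: y0_def y_def normal_form_def vec_eq_iff forall_3)
    also have "\<dots> = Y p - vector [0, f1 (Y p $ 1), f2 (Y p $ 1)]"
      by (simp add: y_eq[OF that] first[OF that])
    finally show ?thesis by (simp add: k_def Y_def)
  qed
  have A: "A_equivalent 0 0 x y0"
    unfolding A_equivalent_def
  proof (intro conjI exI)
    show k: "diffeo_germ k 0 0"
      unfolding k_def by (rule shear_isometry_diffeo_germ[OF T \<open>0 < \<epsilon>\<close> f f0])
    show "\<forall>\<^sub>F r in nhds 0. y0 r = k (x (h r))"
      using near by (rule eventually_mono) (rule y0_eq)
    show "y0 0 = 0"
      using y0_eq[OF V(2)] k \<open>h 0 = 0\<close> \<open>x 0 = 0\<close> by (simp add: diffeo_germ_def)
  qed (use h \<open>x 0 = 0\<close> in auto)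
  show ?thesis
  proof (intro exI conjI)
    show "\<forall>a b. dist (T a) (T b) = dist a b"
      using T by (simp add: orthogonal_transformation_isometry)
    show "\<forall>p\<in>V. l p = tmb_lambda y (adapted_basis y) p \<and> tmb_Lambda y (adapted_basis y) p
        = vector [vector [1, 0], vector [0, tmb_lambda y (adapted_basis y) p]]"
      using basis(2,3) by simp
  qed (use \<open>0 < \<epsilon>\<close> V_def l f \<open>l 0 = 0\<close> y_def R basis(1) A[unfolded y0_def] in auto)
qed

end
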